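(* Let $k\geq 2$, $q\ge 1$ be integers, $\mathcal{A}$ as in the context, and for an integer $m\ge2$ and $0\le a\le m-1$ put $\overline{S}_{n,k}(a;m)=\frac1n\sum_{1\le i\le n,\ i\equiv a \pmod m}X_i$ for the type-$\mathcal{A}$ random walk on $\mathbb{Z}^k$. Then for every integer $r\geq1$ and every $0\le a\le 2^r-1$, almost surely $$\lim_{n\to\infty}\overline{S}_{n,k}(a;2^r)=\begin{cases}\dfrac{2^{k-r}}{2^k-1}\cdot\dfrac{1}{\zeta(k)}, & a \text{ odd},\\[2mm] \dfrac{2^{k-1}-1}{2^{r-1}(2^k-1)}\cdot\dfrac{1}{\zeta(k)}, & a\text{ even},\end{cases}$$ and for every prime $p_1\ge3$ and every $0\le a\le p_1-1$, almost surely $$\lim_{n\to\infty}\overline{S}_{n,k}(a;p_1)=\begin{cases}\dfrac{p_1^{k-1}-1}{p_1^k-1}\cdot\dfrac{1}{\zeta(k)}, & a=0,\\[2mm] \dfrac{p_1^{k-1}}{p_1^k-1}\cdot\dfrac{1}{\zeta(k)}, & a\neq 0.\end{cases}$$ Here $\zeta$ is the Riemann zeta function.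
   Context: $\mathcal{A}=\{\boldsymbol{\alpha}_1,\dots,\boldsymbol{\alpha}_q\}$ is a finite set of vectors $\boldsymbol{\alpha}_t=(\alpha_{t,1},\dots,\alpha_{t,k})$ with $0<\alpha_{t,j}<1$ for all $j$ and $\alpha_{t,1}+\cdots+\alpha_{t,k}=1$. For $\boldsymbol{\alpha}=(\alpha_1,\dots,\alpha_k)$ of this form, a type-$\boldsymbol{\alpha}$ step $\mathbf{w}(\boldsymbol{\alpha})$ is a random vector equal to the $j$-th standard basis vector of $\mathbb{Z}^k$ with probability $\alpha_j$. The type-$\mathcal{A}$ random walk is $\mathbf{p}_0=(0,\dots,0)$, $\mathbf{p}_i=\mathbf{p}_{i-1}+\mathbf{w}(\boldsymbol{\alpha}'_i)$ for $i\ge1$, where at each step a type $\boldsymbol{\alpha}'_i\in\mathcal{A}$ is chosen and the steps are independent. A lattice point $\mathbf{n}=(n_1,\dots,n_k)\in\mathbb{Z}^k$ is visible if there is no other lattice point on the segment joining it to the origin (equivalently $\gcd(n_1,\dots,n_k)=1$). $X_i=1$ if $\mathbf{p}_i$ is visible and $X_i=0$ otherwise. *)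

theory Defs
  imports "HOL-Probability.Probability" "HOL-Computational_Algebra.Primes"
begin

definition zeta_nat :: "nat \<Rightarrow> real" where
  "zeta_nat s = (\<Sum>n. 1 / (real (Suc n)) ^ s)"

text \<open>Standard basis vector e_j of Z^k (coordinates indexed 0..k-1).\<close>
definition basis_vec :: "nat \<Rightarrow> nat \<Rightarrow> int" where
  "basis_vec j = (\<lambda>l. if l = j then 1 else 0)"

definition visible :: "nat \<Rightarrow> (nat \<Rightarrow> int) \<Rightarrow> bool" where
  "visible k n \<longleftrightarrow> Gcd (n ` {..<k}) = 1"

text \<open>Position p_i of the walk: sum of the steps e_{W t} for t = 1..i, where W t is the
  (random) index of the basis vector chosen at step t.\<close>
definition walk :: "(nat \<Rightarrow> 'a \<Rightarrow> nat) \<Rightarrow> nat \<Rightarrow> 'a \<Rightarrow> (nat \<Rightarrow> int)" where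
  "walk W i x = (\<lambda>l. \<Sum>t\<in>{1..i}. basis_vec (W t x) l)"

definition Xvis :: "nat \<Rightarrow> (nat \<Rightarrow> 'a \<Rightarrow> nat) \<Rightarrow> nat \<Rightarrow> 'a \<Rightarrow> real" where
  "Xvis k W i x = (if visible k (walk W i x) then 1 else 0)"

definition S_bar :: "nat \<Rightarrow> (nat \<Rightarrow> 'a \<Rightarrow> nat) \<Rightarrow> nat \<Rightarrow> nat \<Rightarrow> nat \<Rightarrow> 'a \<Rightarrow> real" where
  "S_bar k W m a n x = (1 / real n) * (\<Sum>i\<in>{i\<in>{1..n}. i mod m = a}. Xvis k W i x)"

end

theory Submission
  imports
    Defs
    "HOL-Computational_Algebra.Squarefree"
    "HOL-Computational_Algebra.Nth_Powers"
    "HOL-Number_Theory.Cong"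
begin

text \<open>
  The coordinates of \<open>p\<^sub>j\<close> sum to \<open>j\<close>, so Moebius inversion writes the indicator of visibility at time
  \<open>j\<close> as the sum of \<open>\<mu>(d)\<close> over those divisors \<open>d\<close> of \<open>j\<close> that divide every coordinate. Expanding divisibility by \<open>d\<close>
  in additive characters, the steps act on each character by multiplication with a number of modulus
  less than 1 unless all frequencies agree. Hence, conditionally on the position at time \<open>i\<close>, all
  coordinates at time \<open>j = i + L\<close> are divisible by \<open>d\<close> with probability \<open>d\<^bsup>1 - k\<^esup> + O(exp(- c L / d\<^sup>2))\<close>; for
  large \<open>d\<close> the same expansion in one coordinate bounds this probability by \<open>1 / d + O(log d / sqrt L)\<close>.
  So visibility at time \<open>j\<close> is nearly independent of the past, with density the sum of
  \<open>\<mu>(d) / d\<^bsup>k - 1\<^esup>\<close> over \<open>d\<close> dividing \<open>j\<close>. A second moment bound with power saving gives almost sure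
  convergence along \<open>n = s\<^bsup>32\<^esup>\<close>, monotonicity fills the gaps, and averaging the densities over a residue
  class modulo a prime power yields the constants.
\<close>

subsection \<open>Moebius function and mean densities\<close>

text \<open>Since 0 is not squarefree, the value at 0 is 0. Series over all naturals therefore
  ignore the index d = 0, where the quotients would be divisions by zero.\<close>

definition mu :: "nat \<Rightarrow> real" where
  "mu n = (if squarefree n then (- 1) ^ card (prime_factors n) else 0)"

lemma mu_0 [simp]: "mu 0 = 0" and mu_1 [simp]: "mu (Suc 0) = 1"
  by (simp_all add: mu_def)

lemma abs_mu_le_1: "\<bar>mu n\<bar> \<le> 1"
  by (simp add: mu_def power_abs)

lemma mu_prime_mult:
  assumes "prime p" "\<not> p dvd e"
  shows "mu (p * e) = - mu e"
proof (cases "squarefree e")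
  case True
  have cop: "coprime p e" using assms by (simp add: prime_imp_coprime)
  have e0: "e \<noteq> 0" using assms by (metis dvd_0_right)
  have "squarefree (p * e)"
    using True cop assms by (simp add: squarefree_mult_coprime squarefree_prime)
  moreover have "prime_factors (p * e) = insert p (prime_factors e)"
    using assms e0 by (subst prime_factors_product) (auto simp: prime_factorization_prime)
  moreover have "p \<notin> prime_factors e" using assms by auto
  ultimately show ?thesis using True by (simp add: mu_def)
next
  case False
  then have "\<not> squarefree (p * e)" using squarefree_mono[of e "p * e"] by auto
  then show ?thesis using False by (simp add: mu_def)
qed

lemma mu_eq_0:
  assumes "prime p" "p\<^sup>2 dvd d"
  shows "mu d = 0"
  using assms not_squarefreeI[of p d] by (auto simp: mu_def prime_nat_iff)

lemma mu_prime_mult_dvd: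
  assumes "prime p" "p dvd e"
  shows "mu (p * e) = 0"
  using assms mu_eq_0[of p "p * e"] by (simp add: power2_eq_square)

text \<open>For n > 1 fix a prime p dividing n. The map e -> p * e sends the divisors prime to p to
  divisors with opposite sign, and the remaining divisors, those divisible by the square of p,
  contribute 0.\<close>

lemma sum_mu_divisors:
  assumes "n > 0"
  shows "(\<Sum>d | d dvd n. mu d) = (if n = 1 then 1 else 0)"
proof (cases "n = 1")
  case False
  then obtain p where p: "prime p" "p dvd n"
    using prime_factor_nat by blast
  have fin: "finite {d. d dvd n}" using assms by simp
  have p0: "p > 0" using p prime_gt_0_nat by auto
  have "(\<Sum>d | d dvd n \<and> p dvd d. mu d) = (\<Sum>d\<in>(\<lambda>e. p * e) ` {e. e dvd n \<and> \<not> p dvd e}. mu d)"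
  proof (rule sum.mono_neutral_right)
    show "finite {d. d dvd n \<and> p dvd d}" using fin by (rule finite_subset[rotated]) auto
    show "(\<lambda>e. p * e) ` {e. e dvd n \<and> \<not> p dvd e} \<subseteq> {d. d dvd n \<and> p dvd d}"
      using p by (auto intro!: divides_mult prime_imp_coprime)
    show "\<forall>d\<in>{d. d dvd n \<and> p dvd d} - (\<lambda>e. p * e) ` {e. e dvd n \<and> \<not> p dvd e}. mu d = 0"
    proof
      fix d assume d: "d \<in> {d. d dvd n \<and> p dvd d} - (\<lambda>e. p * e) ` {e. e dvd n \<and> \<not> p dvd e}"
      then obtain e where e: "d = p * e" by (auto elim: dvdE)
      then have "e dvd n" using d dvd_trans[of e d n] by simp
      then have "p dvd e" using d e by auto
      then show "mu d = 0" using p e by (simp add: mu_prime_mult_dvd)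
    qed
  qed
  also have "\<dots> = (\<Sum>e | e dvd n \<and> \<not> p dvd e. mu (p * e))"
    using p0 by (subst sum.reindex) (auto simp: inj_on_def)
  also have "\<dots> = - (\<Sum>e | e dvd n \<and> \<not> p dvd e. mu e)"
    using p by (subst sum_negf[symmetric], intro sum.cong) (auto simp: mu_prime_mult)
  finally have *: "(\<Sum>d | d dvd n \<and> p dvd d. mu d) = - (\<Sum>e | e dvd n \<and> \<not> p dvd e. mu e)" .
  have "(\<Sum>d | d dvd n. mu d) = (\<Sum>d | d dvd n \<and> p dvd d. mu d) + (\<Sum>d | d dvd n \<and> \<not> p dvd d. mu d)"
    using fin by (subst sum.union_disjoint[symmetric]) (auto intro!: sum.cong)
  then show ?thesis using * False by simp
qed auto

section \<open>The Dirichlet series of the Moebius function and zeta\<close>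

lemma summable_inverse_nat_power:
  assumes "k \<ge> 2"
  shows "summable (\<lambda>n. 1 / real n ^ k)"
  using inverse_power_summable[OF assms, where 'a=real] by (simp add: field_simps)

lemma summable_mu:
  assumes "k \<ge> 2"
  shows "summable (\<lambda>n. norm (mu n / real n ^ k))"
  by (rule summable_comparison_test'[OF summable_inverse_nat_power[OF assms], of 0])
     (use abs_mu_le_1 in \<open>auto simp: abs_divide intro!: divide_right_mono\<close>)

text \<open>The product of the two series is an absolutely convergent double sum over pairs (d, e).
  Regrouped by n = d * e, it has inner sums of \<open>mu\<close> over the divisors of n, and only n
  = 1 survives.\<close>

lemma suminf_mu_zeta:
  assumes "k \<ge> 2"
  shows "(\<Sum>n. mu n / real n ^ k) * zeta_nat k = 1"
proof -
  let ?A = "{1::nat..}"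
  let ?f = "\<lambda>d. mu d / real d ^ k" and ?g = "\<lambda>e. 1 / real e ^ k"
  have "(?f has_sum (\<Sum>n. ?f n)) UNIV"
    by (rule norm_summable_imp_has_sum[OF _ summable_sums[OF summable_norm_cancel]])
       (rule summable_mu[OF assms])+
  \<comment> \<open>Both series are moved to positive indices, because the regrouping by products is
    a bijection only there; the terms at 0 vanish.\<close>
  then have fs: "(?f has_sum (\<Sum>n. ?f n)) ?A"
    by (rule has_sum_cong_neutral[THEN iffD1, rotated 3]) (auto simp: not_le)
  have "(?g has_sum (\<Sum>n. ?g n)) UNIV"
    by (rule norm_summable_imp_has_sum) (use summable_inverse_nat_power[OF assms] in auto)
  moreover have "(\<Sum>n. ?g n) = zeta_nat k"
    using suminf_split_head[OF summable_inverse_nat_power[OF assms]] assms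
    by (simp add: zeta_nat_def)
  ultimately have gs: "(?g has_sum zeta_nat k) ?A"
    by (subst has_sum_cong_neutral[where T=UNIV and g="?g"]) (use assms in \<open>auto simp: not_le\<close>)
  have "(\<lambda>d. norm (?f d)) summable_on ?A"
    using norm_summable_imp_summable_on[of "\<lambda>d. norm (?f d)"] summable_mu[OF assms]
    by (auto intro: summable_on_subset_banach)
  then have "(\<lambda>d. norm (?f d) * zeta_nat k) summable_on ?A"
    by (rule summable_on_cmult_left)
  then have "(\<lambda>(d,e). norm (?f d * ?g e)) summable_on ?A \<times> ?A"
  proof (rule summable_on_SigmaI[rotated])
    show "((\<lambda>e. case (d, e) of (d, e) \<Rightarrow> norm (?f d * ?g e)) has_sum norm (?f d) * zeta_nat k) ?A" for d
      using has_sum_cmult_right[OF gs, of "norm (?f d)"] by (simp add: norm_mult)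
  qed auto
  then have prod: "(\<lambda>(d,e). ?f d * ?g e) summable_on ?A \<times> ?A"
    using abs_summable_summable[of "\<lambda>(d,e). ?f d * ?g e"] unfolding case_prod_unfold by blast
  have "((\<lambda>(d,e). ?f d * ?g e) has_sum (\<Sum>n. ?f n) * zeta_nat k) (?A \<times> ?A)"
  proof (rule has_sum_SigmaI[where g="\<lambda>d. ?f d * zeta_nat k"])
    show "((\<lambda>y. case (x, y) of (d, e) \<Rightarrow> ?f d * ?g e) has_sum ?f x * zeta_nat k) ?A" for x
      using has_sum_cmult_right[OF gs, of "?f x"] by simp
    show "((\<lambda>d. ?f d * zeta_nat k) has_sum (\<Sum>n. ?f n) * zeta_nat k) ?A"
      using has_sum_cmult_left[OF fs] by simp
    show "(\<lambda>(d,e). ?f d * ?g e) summable_on ?A \<times> ?A"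
      by (rule prod)
  qed
  also have "?this \<longleftrightarrow> ((\<lambda>(n,d). mu d / real n ^ k) has_sum (\<Sum>n. ?f n) * zeta_nat k) (SIGMA n:?A. {d. d dvd n})"
    by (rule has_sum_reindex_bij_witness[where i="\<lambda>(n,d). (d, n div d)" and j="\<lambda>(d,e). (d * e, d)"])
       (auto simp: power_mult_distrib intro!: Suc_leI)
  finally have "((\<lambda>n. \<Sum>d | d dvd n. mu d / real n ^ k) has_sum (\<Sum>n. ?f n) * zeta_nat k) ?A"
    by (rule has_sum_SigmaD) (auto intro!: has_sum_finite)
  also have "?this \<longleftrightarrow> ((\<lambda>n. if n = 1 then 1 else 0) has_sum (\<Sum>n. ?f n) * zeta_nat k) ?A"
    by (rule has_sum_cong) (auto simp: sum_divide_distrib[symmetric] sum_mu_divisors)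
  also have "\<dots> \<longleftrightarrow> ((\<lambda>n. 1) has_sum (\<Sum>n. ?f n) * zeta_nat k) {1::nat}"
    by (rule has_sum_cong_neutral) auto
  finally show ?thesis
    using has_sum_unique has_sum_finite[of "{1::nat}" "\<lambda>_. 1::real"] by fastforce
qed

section \<open>Counting integers in residue classes\<close>

lemma card_residue_class:
  assumes "0 < N" "b < N"
  shows "\<bar>real (card {i\<in>{1..n}. i mod N = b}) - real n / real N\<bar> \<le> 2"
proof -
  let ?S = "{i\<in>{1..n}. i mod N = b}" and ?q = "n div N"
  have inj: "inj_on (\<lambda>t. N * t + b) A" for A
    using assms by (auto simp: inj_on_def)
  have "(\<lambda>t. N * t + b) ` {1..<?q} \<subseteq> ?S"
  proof safe
    fix t assume t: "t \<in> {1..<?q}"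
    then have "N * (t + 1) \<le> N * ?q" by (intro mult_le_mono) auto
    also have "\<dots> \<le> n" by simp
    finally have "N * t + b \<le> n" using assms by simp
    moreover have "1 \<le> N * t" using t assms by simp
    ultimately show "N * t + b \<in> {1..n}" by (simp add: le_add1 trans_le_add1)
    show "(N * t + b) mod N = b" using assms by simp
  qed
  from card_mono[OF _ this] have "?q - 1 \<le> card ?S"
    by (simp add: card_image[OF inj])
  moreover have "?S \<subseteq> (\<lambda>t. N * t + b) ` {0..?q}"
  proof safe
    fix i assume "i \<in> {1..n}" "b = i mod N"
    then show "i \<in> (\<lambda>t. N * t + i mod N) ` {0..?q}"
      by (intro image_eqI[of _ _ "i div N"]) (auto intro: div_le_mono)
  qed
  from card_mono[OF _ this] have "card ?S \<le> ?q + 1"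
    by (simp add: card_image[OF inj])
  moreover have "real ?q \<le> real n / real N"
    by (rule of_nat_div_le_of_nat)
  moreover have "real n / real N < real ?q + 1"
  proof -
    have "n < N * (?q + 1)" using assms by (metis dividend_less_times_div mult_Suc_right Suc_eq_plus1 add.commute)
    then have "real n < real N * (real ?q + 1)" by (metis of_nat_less_iff of_nat_mult of_nat_add of_nat_1)
    then show ?thesis using assms by (simp add: field_simps)
  qed
  ultimately show ?thesis by linarith
qed

text \<open>The bound carries no additive error, so after division by n it is uniform in n. This
  supplies the dominating series for Tannery's theorem and the average over large divisors.\<close>

lemma card_multiples_le:
  assumes "0 < e"
  shows "real (card {i\<in>{1..n}. e dvd i \<and> P i}) \<le> real n / real e"
proof -
  have "{i\<in>{1..n}. e dvd i \<and> P i} \<subseteq> (\<lambda>t. e * t) ` {1..n div e}"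
  proof
    fix i assume "i \<in> {i\<in>{1..n}. e dvd i \<and> P i}"
    then obtain t where "i = e * t" "1 \<le> e * t" "e * t \<le> n" by (auto elim: dvdE)
    then show "i \<in> (\<lambda>t. e * t) ` {1..n div e}"
      using assms by (intro image_eqI[of _ _ t]) (auto simp: less_eq_div_iff_mult_less_eq ac_simps Suc_le_eq)
  qed
  from card_mono[OF _ this] have "card {i\<in>{1..n}. e dvd i \<and> P i} \<le> n div e"
    using card_image_le[of "{1..n div e}" "\<lambda>t. e * t"] by simp
  then show ?thesis using of_nat_div_le_of_nat[of n e, where 'a=real] by linarith
qed

text \<open>The Chinese remainder theorem merges the two conditions into a single residue class
  modulo e * m.\<close>

lemma density_coprime:
  assumes "0 < e" "a < m" "coprime e m"
  shows "(\<lambda>n. real (card {i\<in>{1..n}. e dvd i \<and> i mod m = a}) / real n) \<longlonglongrightarrow> 1 / (real e * real m)"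
proof -
  have m: "0 < m" using assms by simp
  obtain x where x: "[x = 0] (mod e)" "[x = a] (mod m)"
    using binary_chinese_remainder_nat[OF assms(3)] by blast
  define N where "N = e * m"
  define b where "b = x mod N"
  have N: "0 < N" "b < N" using assms m by (auto simp: N_def b_def)
  have eq: "e dvd i \<and> i mod m = a \<longleftrightarrow> i mod N = b" for i
  proof -
    have "e dvd i \<and> i mod m = a \<longleftrightarrow> [i = x] (mod e) \<and> [i = x] (mod m)"
      using x assms by (auto simp: cong_def mod_eq_0_iff_dvd)
    also have "\<dots> \<longleftrightarrow> [i = x] (mod N)"
      unfolding N_def using assms(3) by (metis coprime_cong_mult_nat cong_modulus_mult_nat mult.commute)
    finally show ?thesis by (simp add: cong_def b_def)
  qed
  have "(\<lambda>n. real (card {i\<in>{1..n}. i mod N = b}) / real n - 1 / real N) \<longlonglongrightarrow> 0"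
  proof (rule Lim_null_comparison)
    show "\<forall>\<^sub>F n in sequentially. norm (real (card {i\<in>{1..n}. i mod N = b}) / real n - 1 / real N) \<le> 2 / real n"
      using eventually_gt_at_top[of 0]
    proof eventually_elim
      case (elim n)
      have "real (card {i\<in>{1..n}. i mod N = b}) / real n - 1 / real N
         = (real (card {i\<in>{1..n}. i mod N = b}) - real n / real N) / real n"
        using elim by (simp add: field_simps)
      then show ?case
        using card_residue_class[OF N, of n] elim by (simp add: abs_divide divide_right_mono)
    qed
    show "(\<lambda>n. 2 / real n) \<longlonglongrightarrow> 0" by real_asymp
  qed
  then have "(\<lambda>n. real (card {i\<in>{1..n}. i mod N = b}) / real n) \<longlonglongrightarrow> 1 / real N"
    by (simp add: LIM_zero_iff)
  then show ?thesis by (simp add: eq N_def)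
qed

text \<open>This is the heuristic probability of visibility at time i. As the coordinates sum to i,
  a common divisor d must divide i; for such d, divisibility of k - 1 coordinates forces that of the
  last, whence the exponent k - 1.\<close>

definition vis_density :: "nat \<Rightarrow> nat \<Rightarrow> real" where
  "vis_density k i = (\<Sum>d | d dvd i. mu d / real d ^ (k - 1))"

text \<open>Exchanging the sums over i and d gives finitely many nonzero terms, d at most n. Writing
  them as an infinite series makes the index set independent of n, as Tannery's theorem
  requires.\<close>

lemma sums_vis_density:
  "(\<lambda>d. mu d / real d ^ (k - 1) * real (card {i\<in>{1..n}. d dvd i \<and> P i}))
     sums (\<Sum>i | i \<in> {1..n} \<and> P i. vis_density k i)"
proof -
  have "(\<Sum>i | i \<in> {1..n} \<and> P i. vis_density k i)
     = (\<Sum>i | i \<in> {1..n} \<and> P i. \<Sum>d\<in>{1..n}. if d dvd i then mu d / real d ^ (k - 1) else 0)"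
  proof (rule sum.cong[OF refl])
    fix i assume i: "i \<in> {i. i \<in> {1..n} \<and> P i}"
    show "vis_density k i = (\<Sum>d\<in>{1..n}. if d dvd i then mu d / real d ^ (k - 1) else 0)"
      unfolding vis_density_def
    proof (rule sum.mono_neutral_cong_left)
      show "{d. d dvd i} \<subseteq> {1..n}"
      proof
        fix d assume "d \<in> {d. d dvd i}"
        moreover have "0 < i" "i \<le> n" using i by auto
        ultimately show "d \<in> {1..n}"
          using dvd_imp_le[of d i] dvd_pos_nat[of i d] by auto
      qed
    qed auto
  qed
  also have "\<dots> = (\<Sum>d\<in>{1..n}. \<Sum>i | i \<in> {1..n} \<and> P i. if d dvd i then mu d / real d ^ (k - 1) else 0)"
    by (rule sum.swap)
  also have "\<dots> = (\<Sum>d\<in>{1..n}. mu d / real d ^ (k - 1) * real (card {i\<in>{1..n}. d dvd i \<and> P i}))"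
  proof (rule sum.cong[OF refl])
    fix d
    have "(\<Sum>i | i \<in> {1..n} \<and> P i. if d dvd i then mu d / real d ^ (k - 1) else 0)
       = (\<Sum>i | i \<in> {1..n} \<and> d dvd i \<and> P i. mu d / real d ^ (k - 1))"
      by (intro sum.mono_neutral_cong_right) auto
    then show "(\<Sum>i | i \<in> {1..n} \<and> P i. if d dvd i then mu d / real d ^ (k - 1) else 0)
       = mu d / real d ^ (k - 1) * real (card {i\<in>{1..n}. d dvd i \<and> P i})" by simp
  qed
  finally have "(\<Sum>i | i \<in> {1..n} \<and> P i. vis_density k i)
      = (\<Sum>d\<in>{1..n}. mu d / real d ^ (k - 1) * real (card {i\<in>{1..n}. d dvd i \<and> P i}))" .
  moreover have "mu d / real d ^ (k - 1) * real (card {i\<in>{1..n}. d dvd i \<and> P i}) = 0" if "d \<notin> {1..n}" for d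
  proof -
    have "mu d = 0 \<or> {i\<in>{1..n}. d dvd i \<and> P i} = {}"
    proof (cases "d = 0")
      case False
      then have "d > n" using that by auto
      then show ?thesis by (auto dest: dvd_imp_le)
    qed simp
    then show ?thesis by (auto simp del: atLeastAtMost_iff)
  qed
  ultimately show ?thesis by (metis (no_types, lifting) sums_finite finite_atLeastAtMost)
qed

text \<open>After division by n each term of the divisor series converges and is dominated by 1 / d
  ^ k, so Tannery's theorem applies. The limit series splits into the d prime to p
  (\<open>U\<close>) and the multiples of p (\<open>V\<close>). Reindexing d = p * e gives V = - U /
  p ^ k, and (U + V) * zeta = 1 then determines both.\<close>

lemma mean_vis_density:
  assumes "k \<ge> 2" "prime p" "r \<ge> 1" "a < p ^ r"
  shows "(\<lambda>n. (\<Sum>i | i \<in> {1..n} \<and> i mod p ^ r = a. vis_density k i) / real n)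
    \<longlonglongrightarrow> (if p dvd a then real p ^ (k - 1) - 1 else real p ^ (k - 1)) * real p
        / (real p ^ r * (real p ^ k - 1)) * (1 / zeta_nat k)"
proof -
  define m where "m = p ^ r"
  have p0: "p > 0" and p1: "p > 1" using assms prime_gt_0_nat prime_gt_1_nat by auto
  have m0: "m > 0" using p0 by (simp add: m_def)
  have k: "Suc (k - 1) = k" using assms by simp
  define c where "c d n = card {i\<in>{1..n}. d dvd i \<and> i mod m = a}" for d n
  \<comment> \<open>For squarefree d this is the density of the i divisible by d in the class of a.
    If d = p * e, the class already decides whether p divides i: either it is empty of multiples of
    d, or only e remains to be tested and the density is 1 / (e * m). Other d do not matter, since
    \<open>mu d = 0\<close>.\<close>
  define \<rho> where "\<rho> d = (if p dvd d then (if p dvd a then real p / real m else 0) else 1 / real m) / real d" for d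
  have dens: "(\<lambda>n. mu d / real d ^ (k - 1) * (real (c d n) / real n)) \<longlonglongrightarrow> mu d / real d ^ (k - 1) * \<rho> d" for d
  proof -
    consider "mu d = 0" | "mu d \<noteq> 0" "\<not> p dvd d" | "mu d \<noteq> 0" "p dvd d" by blast
    then show ?thesis
    proof cases
      case 1
      then show ?thesis by simp
    next
      case 2
      then have "d > 0" by (metis dvd_0_right gr0I)
      moreover have "coprime d m"
        using 2 prime_imp_coprime[OF assms(2), of d] by (simp add: m_def coprime_commute)
      ultimately have "(\<lambda>n. real (c d n) / real n) \<longlonglongrightarrow> \<rho> d"
        using density_coprime[of d a m] 2 assms by (simp add: c_def \<rho>_def m_def mult.commute)
      then show ?thesis by (intro tendsto_mult tendsto_const)
    next
      case 3
      have pm: "p dvd i \<longleftrightarrow> p dvd a" if "i mod m = a" for i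
        using that assms(3) dvd_mod_iff[of p m i] by (simp add: m_def)
      obtain e where e: "d = p * e" using 3 by (auto elim: dvdE)
      have ne: "\<not> p dvd e" using 3 e mu_prime_mult_dvd[OF assms(2), of e] by auto
      then have e0: "e > 0" by (metis dvd_0_right gr0I)
      have cop: "coprime p e" using ne assms(2) by (simp add: prime_imp_coprime)
      have "(\<lambda>n. real (c d n) / real n) \<longlonglongrightarrow> \<rho> d"
      proof (cases "p dvd a")
        case True
        have "c d n = card {i\<in>{1..n}. e dvd i \<and> i mod m = a}" for n
          unfolding c_def using pm True cop
          by (intro arg_cong[where f=card]) (auto simp: e intro: divides_mult dvd_mult_right)
        moreover have "coprime e m"
          using cop by (simp add: m_def coprime_commute)
        ultimately show ?thesis
          using density_coprime[of e a m] e0 assms 3 True p0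
          by (simp add: \<rho>_def m_def e mult.commute)
      next
        case False
        have "c d n = 0" for n
          unfolding c_def using pm False by (auto simp: e dest: dvd_mult_left)
        then show ?thesis using 3 False by (simp add: \<rho>_def)
      qed
      then show ?thesis by (intro tendsto_mult tendsto_const)
    qed
  qed
  have bound: "norm (mu d / real d ^ (k - 1) * (real (c d n) / real n)) \<le> 1 / real d ^ k" for d n
  proof (cases "d = 0 \<or> n = 0")
    case False
    then have "real (c d n) / real n \<le> 1 / real d"
      using card_multiples_le[of d n "\<lambda>i. i mod m = a"] by (simp add: c_def field_simps)
    then have "norm (mu d / real d ^ (k - 1) * (real (c d n) / real n)) \<le> 1 / real d ^ (k - 1) * (1 / real d)"
      unfolding norm_mult norm_divide using abs_mu_le_1[of d] False
      by (intro mult_mono[OF frac_le]) auto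
    also have "\<dots> = 1 / real d ^ k" by (subst k[symmetric]) simp
    finally show ?thesis .
  qed auto
  have "(\<lambda>n. \<Sum>d. mu d / real d ^ (k - 1) * (real (c d n) / real n)) \<longlonglongrightarrow> (\<Sum>d. mu d / real d ^ (k - 1) * \<rho> d)"
    using tannerys_theorem[OF dens _ summable_inverse_nat_power[OF assms(1)] sequentially_bot] bound
    by (auto simp: case_prod_unfold)
  moreover have "(\<Sum>d. mu d / real d ^ (k - 1) * (real (c d n) / real n))
      = (\<Sum>i | i \<in> {1..n} \<and> i mod p ^ r = a. vis_density k i) / real n" for n
    using sums_unique[OF sums_divide[OF sums_vis_density[of k n "\<lambda>i. i mod m = a"]], of "real n"]
    by (simp add: c_def m_def)
  moreover have "(\<Sum>d. mu d / real d ^ (k - 1) * \<rho> d) =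
    (if p dvd a then real p ^ (k - 1) - 1 else real p ^ (k - 1)) * real p
        / (real p ^ r * (real p ^ k - 1)) * (1 / zeta_nat k)"
  proof -
    define F where "F d = mu d / real d ^ k" for d
    define U where "U = (\<Sum>d. if p dvd d then 0 else F d)"
    define V where "V = (\<Sum>d. if p dvd d then F d else 0)"
    have sF: "summable F" unfolding F_def by (rule summable_norm_cancel[OF summable_mu[OF assms(1)]])
    have snF: "summable (\<lambda>d. norm (F d))" unfolding F_def by (rule summable_mu[OF assms(1)])
    have sU: "summable (\<lambda>d. if p dvd d then 0 else F d)"
      by (rule summable_comparison_test'[OF snF, of 0]) auto
    have sV: "summable (\<lambda>d. if p dvd d then F d else 0)"
      by (rule summable_comparison_test'[OF snF, of 0]) auto
    have "V = (\<Sum>e. if p dvd p * e then F (p * e) else 0)"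
      unfolding V_def using p0
      by (intro suminf_mono_reindex[symmetric]) (auto simp: strict_mono_def elim!: dvdE)
    also have "\<dots> = (\<Sum>e. - (1 / real p ^ k) * (if p dvd e then 0 else F e))"
      using assms(2) by (intro suminf_cong) (auto simp: F_def mu_prime_mult mu_prime_mult_dvd power_mult_distrib)
    also have "\<dots> = - (1 / real p ^ k) * U"
      unfolding U_def by (rule suminf_mult[OF sU])
    finally have V: "V = - (1 / real p ^ k) * U" .
    have "U + V = (\<Sum>d. F d)"
      unfolding U_def V_def suminf_add[OF sU sV] by (intro suminf_cong) auto
    moreover have "(\<Sum>d. F d) * zeta_nat k = 1"
      using suminf_mu_zeta[OF assms(1)] by (simp add: F_def)
    ultimately have UVz: "(U + V) * zeta_nat k = 1" by simp
    then have z: "zeta_nat k \<noteq> 0" by auto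
    have pk: "real p ^ k > 1" using p1 assms(1) by simp
    have U: "U = real p ^ k / (real p ^ k - 1) * (1 / zeta_nat k)"
    proof -
      define P where "P = real p ^ k"
      define x where "x = U * zeta_nat k"
      have P: "P > 1" using pk by (simp add: P_def)
      have "x - x / P = 1"
        using UVz V by (simp add: x_def P_def algebra_simps)
      then have "x * (P - 1) = P" using P by (simp add: field_simps)
      then have "x = P / (P - 1)" using P by (simp add: field_simps)
      moreover have "U = x / zeta_nat k" using z by (simp add: x_def)
      ultimately show ?thesis by (simp add: P_def)
    qed
    have "(\<Sum>d. mu d / real d ^ (k - 1) * \<rho> d)
       = (\<Sum>d. 1 / real m * (if p dvd d then 0 else F d) + (if p dvd a then real p / real m else 0) * (if p dvd d then F d else 0))"
    proof (intro suminf_cong)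
      fix d
      have "real d ^ k = real d ^ (k - 1) * real d" by (subst k[symmetric]) simp
      then show "mu d / real d ^ (k - 1) * \<rho> d = 1 / real m * (if p dvd d then 0 else F d) + (if p dvd a then real p / real m else 0) * (if p dvd d then F d else 0)"
        by (simp add: \<rho>_def F_def)
    qed
    also have "\<dots> = 1 / real m * U + (if p dvd a then real p / real m else 0) * V"
      unfolding U_def V_def
      by (rule sums_unique[symmetric])
         (rule sums_add[OF sums_mult[OF summable_sums[OF sU]] sums_mult[OF summable_sums[OF sV]]])
    also have "\<dots> = (if p dvd a then real p ^ (k - 1) - 1 else real p ^ (k - 1)) * real p
        / (real p ^ r * (real p ^ k - 1)) * (1 / zeta_nat k)"
    proof -
      have pk': "real p ^ k = real p ^ (k - 1) * real p" by (subst k[symmetric]) simp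
      show ?thesis
        using pk p0 z unfolding V U m_def by (simp add: pk' divide_simps) (simp add: algebra_simps)
    qed
    finally show ?thesis .
  qed
  ultimately show ?thesis by simp
qed

subsection \<open>Fourier analysis of the step operators\<close>

text \<open>This is the transition operator of one step acting on test functions. Values in any real
  vector space allow the same operator to act on real indicators and on complex characters.\<close>

definition step_op :: "nat \<Rightarrow> (nat \<Rightarrow> real) \<Rightarrow> ((nat \<Rightarrow> int) \<Rightarrow> 'b::real_vector) \<Rightarrow> (nat \<Rightarrow> int) \<Rightarrow> 'b" where
  "step_op k p f v = (\<Sum>a<k. p a *\<^sub>R f (\<lambda>l. v l + basis_vec a l))"

text \<open>\<open>evol k \<beta> i L f v\<close> is the conditional mean of \<open>f\<close> at the position at time \<open>i + L\<close>, given position \<open>v\<close> at time \<open>i\<close>.\<close>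

primrec evol :: "nat \<Rightarrow> (nat \<Rightarrow> nat \<Rightarrow> real) \<Rightarrow> nat \<Rightarrow> nat \<Rightarrow> ((nat \<Rightarrow> int) \<Rightarrow> 'b::real_vector) \<Rightarrow> (nat \<Rightarrow> int) \<Rightarrow> 'b" where
  "evol k \<beta> i 0 f = f"
| "evol k \<beta> i (Suc L) f = evol k \<beta> i L (step_op k (\<beta> (Suc (i + L))) f)"

lemma step_op_linear:
  "linear T \<Longrightarrow> step_op k p (\<lambda>v. T (f v)) = (\<lambda>v. T (step_op k p f v))"
  by (rule ext) (simp add: step_op_def linear_sum linear_scale)

lemma evol_linear:
  "linear T \<Longrightarrow> evol k \<beta> i L (\<lambda>v. T (f v)) = (\<lambda>v. T (evol k \<beta> i L f v))"
  by (induction L arbitrary: f) (simp_all add: step_op_linear)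

lemma evol_sum:
  "evol k \<beta> i L (\<lambda>v. \<Sum>x\<in>A. f x v) = (\<lambda>v. \<Sum>x\<in>A. evol k \<beta> i L (f x) v)"
proof (induction L arbitrary: f)
  case (Suc L)
  have "step_op k p (\<lambda>v. \<Sum>x\<in>A. f x v) = (\<lambda>v. \<Sum>x\<in>A. step_op k p (f x) v)" for p
    unfolding step_op_def scaleR_sum_right by (intro ext sum.swap)
  then show ?case by (simp add: Suc)
qed simp

lemma evol_mult:
  fixes f :: "(nat \<Rightarrow> int) \<Rightarrow> 'b::real_algebra"
  shows "evol k \<beta> i L (\<lambda>v. c * f v) = (\<lambda>v. c * evol k \<beta> i L f v)"
  by (rule evol_linear) (simp add: bounded_linear.linear linearI distrib_left)

lemma evol_of_real:
  "evol k \<beta> i L (\<lambda>v. of_real (f v) :: complex) = (\<lambda>v. of_real (evol k \<beta> i L f v))"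
  by (rule evol_linear) (simp add: linearI scaleR_conv_of_real)

lemma evol_eigen:
  fixes f :: "(nat \<Rightarrow> int) \<Rightarrow> complex"
  assumes "\<And>t. step_op k (\<beta> t) f = (\<lambda>v. c t * f v)"
  shows "evol k \<beta> i L f v = (\<Prod>t\<in>{i<..i+L}. c t) * f v"
proof (induction L)
  case (Suc L)
  have "{i<..i + Suc L} = insert (Suc (i + L)) {i<..i+L}" by auto
  then show ?case by (simp add: assms evol_mult Suc)
qed simp

section \<open>Divisibility in terms of additive characters\<close>

definition ind_dvd :: "nat \<Rightarrow> nat \<Rightarrow> (nat \<Rightarrow> int) \<Rightarrow> real" where
  "ind_dvd k d v = (if \<forall>l<k. int d dvd v l then 1 else 0)"

definition chr :: "nat \<Rightarrow> nat \<Rightarrow> (nat \<Rightarrow> nat) \<Rightarrow> (nat \<Rightarrow> int) \<Rightarrow> complex" where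
  "chr k d h v = cis (2 * pi / real d * (\<Sum>l<k. real (h l) * real_of_int (v l)))"

text \<open>The characteristic function of one step with distribution p at the frequency vector h /
  d; it is the eigenvalue of the step operator on \<open>chr k d h\<close>.\<close>

definition chr_mult :: "nat \<Rightarrow> nat \<Rightarrow> (nat \<Rightarrow> nat) \<Rightarrow> (nat \<Rightarrow> real) \<Rightarrow> complex" where
  "chr_mult k d h p = (\<Sum>a<k. p a *\<^sub>R cis (2 * pi / real d * real (h a)))"

lemma step_op_chr:
  "step_op k p (chr k d h) = (\<lambda>v. chr_mult k d h p * chr k d h v)"
proof
  fix v
  have "chr k d h (\<lambda>l. v l + basis_vec a l) = cis (2 * pi / real d * real (h a)) * chr k d h v" if "a < k" for a
  proof -
    have "(\<Sum>l<k. real (h l) * real_of_int (v l + basis_vec a l))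
      = (\<Sum>l<k. real (h l) * real_of_int (v l)) + (\<Sum>l<k. if l = a then real (h l) else 0)"
      unfolding sum.distrib[symmetric] by (intro sum.cong) (auto simp: basis_vec_def algebra_simps)
    also have "(\<Sum>l<k. if l = a then real (h l) else 0) = real (h a)"
      using that by simp
    finally show ?thesis by (simp add: chr_def cis_mult algebra_simps)
  qed
  then show "step_op k p (chr k d h) v = chr_mult k d h p * chr k d h v"
    by (simp add: step_op_def chr_mult_def sum_distrib_right)
qed

lemma evol_chr: "evol k \<beta> i L (chr k d h) v = (\<Prod>t\<in>{i<..i+L}. chr_mult k d h (\<beta> t)) * chr k d h v"
  by (rule evol_eigen) (rule step_op_chr)

text \<open>Orthogonality of characters modulo d: a geometric sum over the powers of a d-th root of
  unity, which equals 1 exactly when d divides x.\<close>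

lemma sum_cis_dvd:
  assumes "d > 0"
  shows "(\<Sum>b<d. cis (2 * pi / real d * (real b * real_of_int x))) = (if int d dvd x then of_nat d else 0)"
proof -
  define \<omega> where "\<omega> = cis (2 * pi / real d * real_of_int x)"
  have eq: "(\<Sum>b<d. cis (2 * pi / real d * (real b * real_of_int x))) = (\<Sum>b<d. \<omega> ^ b)"
    by (intro sum.cong) (auto simp: \<omega>_def Complex.DeMoivre mult_ac)
  show ?thesis
  proof (cases "int d dvd x")
    case True
    then obtain y where "x = int d * y" by (auto elim: dvdE)
    then have "\<omega> = cis (2 * pi * real_of_int y)" using assms by (simp add: \<omega>_def mult.assoc del: cis_multiple_2pi)
    then have "\<omega> = 1" by (simp only: cis_multiple_2pi Ints_of_int)
    then show ?thesis using True unfolding eq by simp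
  next
    case False
    have "\<omega> \<noteq> 1"
    proof
      assume "\<omega> = 1"
      then obtain n :: int where "2 * pi / real d * real_of_int x = n * 2 * pi"
        by (auto simp: \<omega>_def complex_eq_iff cos_one_2pi_int)
      then have "real_of_int x = real_of_int (int d * n)" using assms by (simp add: field_simps)
      then have "x = int d * n" by (simp only: of_int_eq_iff)
      then show False using False by simp
    qed
    moreover have "\<omega> ^ d = 1"
    proof -
      have "real d * (2 * pi / real d * real_of_int x) = 2 * pi * real_of_int x"
        using assms by simp
      then show ?thesis by (simp only: \<omega>_def Complex.DeMoivre cis_multiple_2pi Ints_of_int)
    qed
    ultimately show ?thesis using False unfolding eq by (simp add: geometric_sum)
  qed
qed

text \<open>Orthogonality is applied in each coordinate, and the product of k sums is expanded into
  one sum over frequency vectors.\<close>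

lemma ind_dvd_Fourier:
  assumes "d > 0"
  shows "complex_of_real (ind_dvd k d v) = (1 / of_nat d ^ k) * (\<Sum>h\<in>{..<k} \<rightarrow>\<^sub>E {..<d}. chr k d h v)"
proof -
  have "chr k d h v = (\<Prod>l<k. cis (2 * pi / real d * (real (h l) * real_of_int (v l))))" for h
    unfolding chr_def sum_distrib_left by (induction k) (auto simp: cis_mult[symmetric] mult.commute)
  then have "(\<Sum>h\<in>{..<k} \<rightarrow>\<^sub>E {..<d}. chr k d h v)
      = (\<Prod>l<k. \<Sum>b<d. cis (2 * pi / real d * (real b * real_of_int (v l))))"
    by (subst prod_sum_PiE) auto
  also have "\<dots> = (\<Prod>l<k. if int d dvd v l then of_nat d else 0)"
    by (simp only: sum_cis_dvd[OF assms])
  also have "\<dots> = (if \<forall>l<k. int d dvd v l then of_nat d ^ k else 0)"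
    by (auto intro!: prod_zero)
  finally show ?thesis using assms by (simp add: ind_dvd_def)
qed

text \<open>With u = 1 - cos (x - y), the squared modulus is (p + q)^2 - 2 p q u. From p q >=
  \<delta>^2 >= (p + q) \<delta>^2, completing the square gives the bound. Its additive form lets
  the other summands of a step be added by the triangle inequality.\<close>

lemma norm_add_cis_le:
  assumes "0 < \<delta>" "\<delta> \<le> p" "\<delta> \<le> q" "p + q \<le> 1"
  shows "norm (p *\<^sub>R cis x + q *\<^sub>R cis y) \<le> p + q - \<delta>\<^sup>2 * (1 - cos (x - y))"
proof -
  define u where "u = 1 - cos (x - y)"
  have u: "0 \<le> u" "u \<le> 2" using cos_ge_minus_one[of "x - y"] by (auto simp: u_def simp del: cos_ge_minus_one)
  have pq: "\<delta> * \<delta> \<le> p * q" using assms by (intro mult_mono) auto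
  have "(norm (p *\<^sub>R cis x + q *\<^sub>R cis y))\<^sup>2 = (p * cos x + q * cos y)\<^sup>2 + (p * sin x + q * sin y)\<^sup>2"
    by (simp add: cmod_power2)
  also have "\<dots> = p\<^sup>2 * ((cos x)\<^sup>2 + (sin x)\<^sup>2) + q\<^sup>2 * ((cos y)\<^sup>2 + (sin y)\<^sup>2) + 2 * p * q * (cos x * cos y + sin x * sin y)"
    by (simp add: power2_eq_square algebra_simps del: sin_cos_squared_add sin_cos_squared_add2 sin_cos_squared_add3)
  also have "\<dots> = (p + q)\<^sup>2 - 2 * (p * q) * u"
    unfolding sin_cos_squared_add2 by (simp add: u_def cos_diff power2_eq_square algebra_simps)
  also have "\<dots> \<le> (p + q)\<^sup>2 - 2 * ((p + q) * (\<delta> * \<delta>)) * u"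
  proof -
    have "(p + q) * (\<delta> * \<delta>) \<le> 1 * (\<delta> * \<delta>)" using assms by (intro mult_right_mono) auto
    then have "(p + q) * (\<delta> * \<delta>) \<le> p * q" using pq by simp
    then show ?thesis using u by (simp add: mult_right_mono)
  qed
  also have "\<dots> \<le> (p + q - \<delta>\<^sup>2 * u)\<^sup>2"
    using zero_le_power2[of "\<delta>\<^sup>2 * u"] by (simp add: power2_eq_square algebra_simps)
  finally have "(norm (p *\<^sub>R cis x + q *\<^sub>R cis y))\<^sup>2 \<le> (p + q - \<delta>\<^sup>2 * u)\<^sup>2" .
  moreover have "0 \<le> p + q - \<delta>\<^sup>2 * u"
  proof -
    have "\<delta> * \<delta> * u \<le> \<delta> * \<delta> * 2" using u by (intro mult_left_mono) auto
    also have "\<dots> \<le> \<delta> * 2" using assms by (intro mult_right_mono mult_left_le) auto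
    also have "\<dots> \<le> p + q" using assms by simp
    finally show ?thesis by (simp add: power2_eq_square)
  qed
  ultimately show ?thesis unfolding u_def by (rule power2_le_imp_le)
qed

text \<open>By concavity the sine lies above its chord between 0 and pi / 2.\<close>

lemma sin_ge_chord:
  assumes "0 \<le> x" "x \<le> 1 / 2"
  shows "2 * x \<le> sin (pi * x)"
proof -
  have "concave_on {0..pi} sin"
    by (rule f''_le0_imp_concave[where f'=cos and f''="\<lambda>x. - sin x"])
       (auto intro!: derivative_eq_intros sin_ge_zero)
  from concave_onD[OF this, of "2 * x" 0 "pi / 2"] show ?thesis
    using assms by (simp add: mult.commute)
qed

text \<open>Here \<open>min m (d - m)\<close> is the distance from m to the nearest multiple of d.
  The constant 8 is 2 * 2^2, from 1 - cos (2 y) = 2 (sin y)^2 and the chord bound.\<close>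

lemma one_minus_cos_ge:
  fixes d m :: nat
  assumes "0 < d" "m \<le> d"
  shows "1 - cos (2 * pi / real d * real m) \<ge> 8 * (real (min m (d - m)) / real d)\<^sup>2"
proof -
  define x where "x = real (min m (d - m)) / real d"
  have x: "0 \<le> x" "x \<le> 1 / 2" using assms by (auto simp: x_def field_simps)
  have "cos (2 * pi / real d * real m) = cos (2 * (pi * x))"
  proof (cases "m \<le> d - m")
    case False
    then have "2 * (pi * x) = 2 * pi - 2 * pi / real d * real m"
      using assms by (simp add: x_def of_nat_diff min_def field_simps)
    then show ?thesis by simp
  qed (simp add: x_def min_def mult.assoc)
  then have "1 - cos (2 * pi / real d * real m) = 2 * (sin (pi * x))\<^sup>2"
    by (simp add: cos_double_sin)
  moreover have "(2 * x)\<^sup>2 \<le> (sin (pi * x))\<^sup>2"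
    using sin_ge_chord[OF x] x by (intro power_mono) auto
  ultimately show ?thesis unfolding x_def[symmetric] by (simp add: power_mult_distrib)
qed

text \<open>The distributions \<open>\<beta> t\<close> may vary arbitrarily with time. The
  finiteness of the set of types enters only through the uniform lower bound \<delta>.\<close>

locale step_probs =
  fixes k :: nat and \<delta> :: real and \<beta> :: "nat \<Rightarrow> nat \<Rightarrow> real"
  assumes k2: "k \<ge> 2" and \<delta>: "0 < \<delta>"
    and \<beta>_ge: "\<And>t a. t \<ge> 1 \<Longrightarrow> a < k \<Longrightarrow> \<delta> \<le> \<beta> t a"
    and \<beta>_sum: "\<And>t. t \<ge> 1 \<Longrightarrow> (\<Sum>a<k. \<beta> t a) = 1"
begin

lemma \<beta>_nonneg: "t \<ge> 1 \<Longrightarrow> a < k \<Longrightarrow> 0 \<le> \<beta> t a"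
  using \<beta>_ge[of t a] \<delta> by linarith

lemma evol_mono:
  fixes f g :: "(nat \<Rightarrow> int) \<Rightarrow> real"
  assumes "\<And>v. f v \<le> g v"
  shows "evol k \<beta> i L f v \<le> evol k \<beta> i L g v"
  using assms
proof (induction L arbitrary: f g)
  case (Suc L)
  then show ?case
    by (auto simp: step_op_def intro!: Suc.IH sum_mono mult_left_mono \<beta>_nonneg)
qed simp

section \<open>Decay of characters and probabilities of divisibility\<close>

lemma norm_chr_mult_le_1:
  assumes "t \<ge> 1"
  shows "norm (chr_mult k d h (\<beta> t)) \<le> 1"
proof -
  have "norm (chr_mult k d h (\<beta> t)) \<le> (\<Sum>a<k. \<beta> t a)"
    unfolding chr_mult_def by (rule sum_norm_le) (simp add: \<beta>_nonneg[OF assms])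
  then show ?thesis using \<beta>_sum[OF assms] by simp
qed

text \<open>Two coordinates with different frequencies already cause cancellation; all others are
  bounded trivially. The exponential form is convenient for multiplying over the steps.\<close>

lemma norm_chr_mult_le:
  assumes "t \<ge> 1" "a < k" "b < k" "a \<noteq> b"
  shows "norm (chr_mult k d h (\<beta> t)) \<le> exp (- \<delta>\<^sup>2 * (1 - cos (2 * pi / real d * (real (h a) - real (h b)))))"
proof -
  let ?c = "\<lambda>a. \<beta> t a *\<^sub>R cis (2 * pi / real d * real (h a))"
  have split: "(\<Sum>a<k. F a) = F a + F b + (\<Sum>c\<in>{..<k}-{a,b}. F c)" for F :: "nat \<Rightarrow> 'b::comm_monoid_add"
    using assms by (subst sum.subset_diff[of "{a,b}"]) (auto simp: add_ac)
  have s: "\<beta> t a + \<beta> t b + (\<Sum>c\<in>{..<k}-{a,b}. \<beta> t c) = 1"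
    using \<beta>_sum[OF assms(1)] split[of "\<beta> t"] by simp
  have nn: "0 \<le> (\<Sum>c\<in>{..<k}-{a,b}. \<beta> t c)"
    using assms by (intro sum_nonneg \<beta>_nonneg) auto
  have "norm (chr_mult k d h (\<beta> t)) \<le> norm (?c a + ?c b) + norm (\<Sum>c\<in>{..<k}-{a,b}. ?c c)"
    unfolding chr_mult_def split[of ?c] by (rule norm_triangle_ineq)
  also have "norm (\<Sum>c\<in>{..<k}-{a,b}. ?c c) \<le> (\<Sum>c\<in>{..<k}-{a,b}. \<beta> t c)"
    by (rule sum_norm_le) (simp add: \<beta>_nonneg[OF assms(1)])
  also have "norm (?c a + ?c b) \<le> \<beta> t a + \<beta> t b - \<delta>\<^sup>2 * (1 - cos (2 * pi / real d * real (h a) - 2 * pi / real d * real (h b)))"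
    using assms \<delta> s nn by (intro norm_add_cis_le \<beta>_ge) auto
  finally have "norm (chr_mult k d h (\<beta> t)) \<le> 1 + (- \<delta>\<^sup>2 * (1 - cos (2 * pi / real d * (real (h a) - real (h b)))))"
    using s by (simp add: right_diff_distrib)
  also have "\<dots> \<le> exp (- \<delta>\<^sup>2 * (1 - cos (2 * pi / real d * (real (h a) - real (h b)))))"
    by (rule exp_ge_add_one_self)
  finally show ?thesis .
qed

lemma norm_evol_chr_le:
  assumes "a < k" "b < k" "h a = h b + m" "m \<le> d" "0 < d"
  shows "norm (evol k \<beta> i L (chr k d h) v) \<le> exp (- 8 * \<delta>\<^sup>2 * real L * (real (min m (d - m)) / real d)\<^sup>2)"
proof (cases "a = b")
  case True
  have "norm (evol k \<beta> i L (chr k d h) v) \<le> 1"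
    unfolding evol_chr norm_mult prod_norm[symmetric]
    by (auto simp: chr_def norm_chr_mult_le_1 intro!: prod_le_1)
  then show ?thesis using True assms by simp
next
  case False
  define x where "x = (real (min m (d - m)) / real d)\<^sup>2"
  have *: "norm (chr_mult k d h (\<beta> t)) \<le> exp (- 8 * \<delta>\<^sup>2 * x)" if "t \<ge> 1" for t
  proof -
    have "norm (chr_mult k d h (\<beta> t)) \<le> exp (- \<delta>\<^sup>2 * (1 - cos (2 * pi / real d * real m)))"
      using norm_chr_mult_le[OF that assms(1,2) False, of d h] assms by simp
    also have "\<dots> \<le> exp (- \<delta>\<^sup>2 * (8 * x))"
      using one_minus_cos_ge[OF assms(5,4)] by (simp add: x_def mult_left_mono)
    finally show ?thesis by (simp add: mult_ac)
  qed
  have "norm (evol k \<beta> i L (chr k d h) v) = (\<Prod>t\<in>{i<..i+L}. norm (chr_mult k d h (\<beta> t)))"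
    unfolding evol_chr norm_mult prod_norm[symmetric] by (simp add: chr_def)
  also have "\<dots> \<le> (\<Prod>t\<in>{i<..i+L}. exp (- 8 * \<delta>\<^sup>2 * x))"
    using * by (intro prod_mono) auto
  also have "\<dots> = exp (- 8 * \<delta>\<^sup>2 * real L * x)"
    by (simp add: exp_of_nat_mult[symmetric] mult_ac)
  finally show ?thesis by (simp add: x_def)
qed

text \<open>For a modulus that is small compared with \<open>sqrt L\<close> only the constant frequencies survive.\<close>

lemma evol_ind_dvd_small:
  assumes "0 < d" and dvd: "int d dvd (\<Sum>l<k. v l) + int L"
  shows "\<bar>evol k \<beta> i L (ind_dvd k d) v - 1 / real d ^ (k - 1)\<bar> \<le> exp (- 8 * \<delta>\<^sup>2 * real L / (real d)\<^sup>2)"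
proof -
  let ?P = "{..<k} \<rightarrow>\<^sub>E {..<d}"
  \<comment> \<open>The constant frequency vectors. They yield the main term, and all others the
    error.\<close>
  define C where "C = (\<lambda>b. restrict (\<lambda>_. b) {..<k}) ` {..<d}"
  let ?E = "\<lambda>h. evol k \<beta> i L (chr k d h) v"
  have kk: "Suc (k - 1) = k" and k0: "0 < k" using k2 by auto
  have inj: "inj_on (\<lambda>b. restrict (\<lambda>_. b) {..<k}) {..<d}"
    using k0 by (auto simp: inj_on_def restrict_def fun_eq_iff)
  have CP: "C \<subseteq> ?P" by (auto simp: C_def split: if_splits)
  have finP: "finite ?P" by (intro finite_PiE) auto
  \<comment> \<open>A constant frequency sees only the sum of the coordinates, which every step
    raises by exactly 1. After L steps the sum is a multiple of d, so the character equals 1. The d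
    such vectors contribute d / d ^ k.\<close>
  have const: "?E h = 1" if "h \<in> C" for h
  proof -
    from that obtain b where h: "h = restrict (\<lambda>_. b) {..<k}" by (auto simp: C_def)
    have cm: "chr_mult k d h (\<beta> t) = cis (2 * pi / real d * real b)" if "t \<ge> 1" for t
    proof -
      have "chr_mult k d h (\<beta> t) = (\<Sum>a<k. \<beta> t a) *\<^sub>R cis (2 * pi / real d * real b)"
        by (simp add: chr_mult_def h scaleR_sum_left)
      then show ?thesis using \<beta>_sum[OF that] by simp
    qed
    have "?E h = cis (2 * pi / real d * real b) ^ L * chr k d h v"
      unfolding evol_chr by (simp add: cm)
    also have "chr k d h v = cis (2 * pi / real d * (real b * real_of_int (\<Sum>l<k. v l)))"
      by (simp add: chr_def h sum_distrib_left)
    also have "cis (2 * pi / real d * real b) ^ L * \<dots> = cis (2 * pi / real d * (real b * real_of_int ((\<Sum>l<k. v l) + int L)))"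
      by (simp add: Complex.DeMoivre cis_mult algebra_simps)
    also have "\<dots> = 1"
    proof -
      obtain y where "(\<Sum>l<k. v l) + int L = int d * y" using dvd by (auto elim: dvdE)
      then have "2 * pi / real d * (real b * real_of_int ((\<Sum>l<k. v l) + int L)) = 2 * pi * real_of_int (int b * y)"
        using assms(1) by simp
      then show ?thesis by (simp only: cis_multiple_2pi Ints_of_int)
    qed
    finally show ?thesis .
  qed
  \<comment> \<open>A nonconstant vector has two entries whose difference m satisfies 0 < m < d, so
    its distance to the multiples of d is at least 1.\<close>
  have rest: "norm (?E h) \<le> exp (- 8 * \<delta>\<^sup>2 * real L / (real d)\<^sup>2)" if "h \<in> ?P - C" for h
  proof -
    from that have hP: "h \<in> ?P" by (rule DiffD1)
    have hlt: "h a < d" if "a < k" for a using PiE_mem[OF hP, of a] that by simp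
    have "\<exists>a<k. h 0 \<noteq> h a"
    proof (rule ccontr)
      assume "\<not> (\<exists>a<k. h 0 \<noteq> h a)"
      then have eq0: "\<forall>x<k. h 0 = h x" by simp
      have "h x = undefined" if "\<not> x < k" for x
        by (rule PiE_arb[OF hP]) (use that in simp)
      then have "h x = restrict (\<lambda>_. h 0) {..<k} x" for x
        using eq0[rule_format, of x] by (cases "x < k") (simp_all del: not_less)
      then have hr: "h = restrict (\<lambda>_. h 0) {..<k}" by (rule ext)
      have hC: "restrict (\<lambda>_. h 0) {..<k} \<in> C"
        unfolding C_def by (rule imageI) (simp only: lessThan_iff hlt[OF k0])
      have "h \<in> C" by (rule subst[of _ h "\<lambda>z. z \<in> C", OF hr[symmetric] hC])
      then show False by (rule DiffD2[OF that])
    qed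
    then obtain c where c: "c < k" "h 0 \<noteq> h c" by blast
    obtain a b where ab: "a < k" "b < k" "h b < h a"
      using that[of c 0] that[of 0 c] c k0 by (cases "h c < h 0") auto
    have ha: "h a < d" by (rule hlt[OF ab(1)])
    define m where "m = h a - h b"
    have m: "h a = h b + m" "0 < m" "m < d" using ab ha by (auto simp: m_def)
    have "norm (?E h) \<le> exp (- 8 * \<delta>\<^sup>2 * real L * (real (min m (d - m)) / real d)\<^sup>2)"
      using norm_evol_chr_le[OF ab(1,2) m(1)] m assms(1) by simp
    also have "\<dots> \<le> exp (- 8 * \<delta>\<^sup>2 * real L * (1 / real d)\<^sup>2)"
    proof -
      have "(1 / real d)\<^sup>2 \<le> (real (min m (d - m)) / real d)\<^sup>2"
        using m by (intro power_mono divide_right_mono) auto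
      then have "8 * \<delta>\<^sup>2 * real L * (1 / real d)\<^sup>2 \<le> 8 * \<delta>\<^sup>2 * real L * (real (min m (d - m)) / real d)\<^sup>2"
        by (intro mult_left_mono) auto
      then show ?thesis by simp
    qed
    finally show ?thesis by (simp add: power_divide)
  qed
  have "complex_of_real (evol k \<beta> i L (ind_dvd k d) v) = (1 / of_nat d ^ k) * (\<Sum>h\<in>?P. ?E h)"
    unfolding evol_of_real[THEN fun_cong, symmetric] ind_dvd_Fourier[OF assms(1)] evol_mult evol_sum ..
  also have "(\<Sum>h\<in>?P. ?E h) = (\<Sum>h\<in>?P - C. ?E h) + (\<Sum>h\<in>C. ?E h)"
    using finP CP by (rule sum.subset_diff[rotated])
  also have "(\<Sum>h\<in>C. ?E h) = of_nat d"
    using const card_image[OF inj] by (simp add: C_def)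
  also have "(1 / of_nat d ^ k) * ((\<Sum>h\<in>?P - C. ?E h) + of_nat d) = (1 / of_nat d ^ k) * (\<Sum>h\<in>?P - C. ?E h) + 1 / of_nat d ^ (k - 1)"
  proof -
    have "(of_nat d :: complex) ^ k = of_nat d * of_nat d ^ (k - 1)" by (metis kk power_Suc)
    then show ?thesis using assms(1) by (simp add: distrib_left)
  qed
  finally have "complex_of_real (evol k \<beta> i L (ind_dvd k d) v - 1 / real d ^ (k - 1)) = (1 / of_nat d ^ k) * (\<Sum>h\<in>?P - C. ?E h)"
    by simp
  from arg_cong[OF this, of norm]
  have eq: "\<bar>evol k \<beta> i L (ind_dvd k d) v - 1 / real d ^ (k - 1)\<bar> = (1 / real d ^ k) * norm (\<Sum>h\<in>?P - C. ?E h)"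
    unfolding norm_of_real by (simp add: norm_mult norm_divide norm_power)
  \<comment> \<open>There are at most d ^ k remaining frequencies, which cancels the Fourier
    prefactor; hence the error carries no power of d.\<close>
  have "norm (\<Sum>h\<in>?P - C. ?E h) \<le> real (card (?P - C)) * exp (- 8 * \<delta>\<^sup>2 * real L / (real d)\<^sup>2)"
    by (rule sum_norm_bound) (rule rest)
  also have "\<dots> \<le> real d ^ k * exp (- 8 * \<delta>\<^sup>2 * real L / (real d)\<^sup>2)"
  proof (rule mult_right_mono)
    have "card (?P - C) \<le> d ^ k"
      using card_mono[OF finP, of "?P - C"] by (simp add: card_PiE)
    then show "real (card (?P - C)) \<le> real d ^ k" by (metis of_nat_le_iff of_nat_power)
  qed simp
  finally have "(1 / real d ^ k) * norm (\<Sum>h\<in>?P - C. ?E h) \<le> (1 / real d ^ k) * (real d ^ k * exp (- 8 * \<delta>\<^sup>2 * real L / (real d)\<^sup>2))"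
    by (rule mult_left_mono) simp
  then show ?thesis unfolding eq using assms(1) by simp
qed

text \<open>Trading Gaussian decay for 1 / y is lossy, but it turns the later sum over frequencies
  into a harmonic sum.\<close>

lemma exp_neg_square_le:
  fixes y :: real
  assumes "0 < y"
  shows "exp (- y\<^sup>2) \<le> 1 / (2 * y)"
proof -
  have "2 * y \<le> 1 + y\<^sup>2"
    using zero_le_power2[of "y - 1"] by (simp add: power2_diff)
  also have "\<dots> \<le> exp (y\<^sup>2)" by (rule exp_ge_add_one_self)
  finally show ?thesis using assms by (simp add: exp_minus field_simps)
qed

text \<open>For large moduli a single coordinate already forces divisibility to be rare.\<close>

lemma evol_ind_dvd_large:
  assumes "0 < d" "0 < L"
  shows "\<bar>evol k \<beta> i L (ind_dvd k d) v\<bar> \<le> 1 / real d + harm d / (2 * \<delta> * sqrt (real L))"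
proof -
  \<comment> \<open>Frequency vectors supported on coordinate 0. As k >= 2, coordinate 1 has
    frequency 0, and the difference of the two is b.\<close>
  define H where "H b = (\<lambda>l::nat. if l = 0 then b else 0 :: nat)" for b
  let ?E = "\<lambda>b. evol k \<beta> i L (chr k d (H b)) v"
  define f where "f = ind_dvd 1 d"
  have k0: "0 < k" "1 < k" using k2 by auto
  \<comment> \<open>The evolution of the zero function is computed as that of an empty sum.\<close>
  have "0 \<le> evol k \<beta> i L (ind_dvd k d) v"
    using evol_mono[of "\<lambda>_. 0" "ind_dvd k d" i L v] evol_sum[of k \<beta> i L "\<lambda>_ _. 0::real" "{}::nat set"]
    by (simp add: ind_dvd_def)
  moreover have "evol k \<beta> i L (ind_dvd k d) v \<le> evol k \<beta> i L f v"
    using k0 by (intro evol_mono) (simp add: ind_dvd_def f_def)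
  moreover have "evol k \<beta> i L f v \<le> 1 / real d + harm d / (2 * \<delta> * sqrt (real L))"
  proof -
    have "chr k d (H b) v = cis (2 * pi / real d * (real b * real_of_int (v 0)))" for b v
    proof -
      have "(\<Sum>l<k. real (H b l) * real_of_int (v l)) = (\<Sum>l<k. if l = 0 then real b * real_of_int (v 0) else 0)"
        by (intro sum.cong) (auto simp: H_def)
      then show ?thesis using k0 by (simp add: chr_def)
    qed
    then have "(\<lambda>v. complex_of_real (f v)) = (\<lambda>v. (1 / of_nat d) * (\<Sum>b<d. chr k d (H b) v))"
      using assms by (simp only: sum_cis_dvd[OF assms(1)]) (auto simp: f_def ind_dvd_def)
    then have "complex_of_real (evol k \<beta> i L f v) = (1 / of_nat d) * (\<Sum>b<d. ?E b)"
      by (simp only: evol_of_real[THEN fun_cong, symmetric] evol_mult evol_sum)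
    then have norm_eq: "\<bar>evol k \<beta> i L f v\<bar> = (1 / real d) * norm (\<Sum>b<d. ?E b)"
      by (metis norm_of_real norm_mult norm_divide norm_one norm_of_nat)
    have "norm (\<Sum>b<d. ?E b) \<le> (\<Sum>b<d. norm (?E b))" by (rule norm_sum)
    also have "\<dots> = norm (?E 0) + (\<Sum>b\<in>{1..<d}. norm (?E b))"
      using assms by (simp add: lessThan_atLeast0 sum.atLeast_Suc_lessThan)
    finally have split: "norm (\<Sum>b<d. ?E b) \<le> norm (?E 0) + (\<Sum>b\<in>{1..<d}. norm (?E b))" .
    have E0: "norm (?E 0) \<le> 1"
      using norm_evol_chr_le[of 0 1 "H 0" 0 d i L v] assms k0 by (simp add: H_def)
    have "(\<Sum>b\<in>{1..<d}. norm (?E b)) \<le> (\<Sum>b\<in>{1..<d}. real d / (4 * \<delta> * sqrt (real L)) * (1 / real b + 1 / real (d - b)))"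
    proof (rule sum_mono)
      fix b assume b: "b \<in> {1..<d}"
      define s where "s = min b (d - b)"
      have s: "0 < s" using b by (auto simp: s_def)
      \<comment> \<open>With this choice the square of y is half of the available exponent.\<close>
      define y where "y = 2 * \<delta> * sqrt (real L) * (real s / real d)"
      have y: "0 < y" using s assms \<delta> by (simp add: y_def)
      have y2: "y\<^sup>2 = 4 * \<delta>\<^sup>2 * real L * (real s / real d)\<^sup>2"
        unfolding y_def power_mult_distrib by simp
      have "norm (?E b) \<le> exp (- 8 * \<delta>\<^sup>2 * real L * (real s / real d)\<^sup>2)"
        using norm_evol_chr_le[of 0 1 "H b" b d i L v] assms k0 b by (simp add: H_def s_def)
      also have "\<dots> \<le> exp (- y\<^sup>2)" unfolding y2 by simp
      also have "\<dots> \<le> 1 / (2 * y)" by (rule exp_neg_square_le[OF y])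
      also have "\<dots> = real d / (4 * \<delta> * sqrt (real L)) * (1 / real s)"
        by (simp add: y_def)
      \<comment> \<open>The reciprocal of a minimum is at most the sum of the reciprocals; by the
        symmetry b -> d - b both parts have the same harmonic sum.\<close>
      also have "\<dots> \<le> real d / (4 * \<delta> * sqrt (real L)) * (1 / real b + 1 / real (d - b))"
        using \<delta> by (intro mult_left_mono) (auto simp: s_def min_def)
      finally show "norm (?E b) \<le> real d / (4 * \<delta> * sqrt (real L)) * (1 / real b + 1 / real (d - b))" .
    qed
    also have "\<dots> = real d / (4 * \<delta> * sqrt (real L)) * ((\<Sum>b\<in>{1..<d}. 1 / real b) + (\<Sum>b\<in>{1..<d}. 1 / real (d - b)))"
      unfolding sum.distrib[symmetric] by (rule sum_distrib_left[symmetric])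
    also have "(\<Sum>b\<in>{1..<d}. 1 / real (d - b)) = (\<Sum>b\<in>{1..<d}. 1 / real b)"
      by (rule sum.reindex_bij_witness[where i="\<lambda>b. d - b" and j="\<lambda>b. d - b"]) auto
    finally have "(\<Sum>b\<in>{1..<d}. norm (?E b)) \<le> real d / (4 * \<delta> * sqrt (real L)) * ((\<Sum>b\<in>{1..<d}. 1 / real b) + (\<Sum>b\<in>{1..<d}. 1 / real b))" .
    also have "\<dots> \<le> real d / (4 * \<delta> * sqrt (real L)) * (harm d + harm d)"
    proof -
      have "(\<Sum>b\<in>{1..<d}. 1 / real b) \<le> harm d"
        unfolding harm_def inverse_eq_divide by (rule sum_mono2) auto
      then show ?thesis using \<delta> by (intro mult_left_mono) auto
    qed
    finally have "norm (\<Sum>b<d. ?E b) \<le> 1 + real d * (harm d / (2 * \<delta> * sqrt (real L)))"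
      using split E0 by (simp add: mult_ac)
    then have "\<bar>evol k \<beta> i L f v\<bar> \<le> (1 / real d) * (1 + real d * (harm d / (2 * \<delta> * sqrt (real L))))"
      unfolding norm_eq by (rule mult_left_mono) simp
    also have "\<dots> = 1 / real d + harm d / (2 * \<delta> * sqrt (real L))"
      using assms by (simp add: distrib_left)
    finally show ?thesis by linarith
  qed
  ultimately show ?thesis by linarith
qed

end

subsection \<open>The Markov property and decay of correlations\<close>

lemma walk_0: "walk V 0 x = (\<lambda>l. 0)"
  by (simp add: walk_def)

lemma walk_Suc: "walk V (Suc i) x = (\<lambda>l. walk V i x l + basis_vec (V (Suc i) x) l)"
  by (simp add: walk_def)

lemma walk_cong: "(\<And>t. t \<in> {1..i} \<Longrightarrow> V t x = V' t x') \<Longrightarrow> walk V i x = walk V' i x'"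
  by (simp add: walk_def)

text \<open>Positions lie in an uncountable type with the discrete sigma-algebra, so measurability
  is built up step by step, each step choosing among countably many shifts. The space and the
  process are kept general: the lemma also serves for coordinate projections on a product
  space.\<close>

lemma measurable_walk:
  assumes "\<And>t. t \<in> {1..i} \<Longrightarrow> V t \<in> measurable N (count_space UNIV)"
  shows "walk V i \<in> measurable N (count_space UNIV)"
  using assms
proof (induction i)
  case 0
  have "walk V 0 = (\<lambda>x l. 0)" by (rule ext) (rule walk_0)
  then show ?case by simp
next
  case (Suc i)
  have "(\<lambda>x. (\<lambda>a x. (\<lambda>l. walk V i x l + basis_vec a l)) (V (Suc i) x) x) \<in> measurable N (count_space UNIV)"
  proof (rule measurable_compose_countable)
    show "(\<lambda>x. (\<lambda>l. walk V i x l + basis_vec a l)) \<in> measurable N (count_space UNIV)" for a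
      using Suc by (intro measurable_compose[OF _ measurable_count_space, of "walk V i"]) auto
    show "V (Suc i) \<in> measurable N (count_space UNIV)" using Suc.prems by simp
  qed
  then show ?case unfolding walk_Suc[abs_def] .
qed

text \<open>Integrability need not be checked: the integral of a nonintegrable function is 0 by
  convention, which is why \<open>0 \<le> c\<close> is assumed.\<close>

lemma (in prob_space) abs_expectation_le:
  fixes f :: "'a \<Rightarrow> real"
  assumes "AE x in M. \<bar>f x\<bar> \<le> c" "0 \<le> c"
  shows "\<bar>expectation f\<bar> \<le> c"
proof (cases "integrable M f")
  case True
  have "\<bar>expectation f\<bar> \<le> expectation (\<lambda>x. \<bar>f x\<bar>)" by (rule integral_abs_bound)
  also have "\<dots> \<le> c" using True assms(1) by (intro integral_le_const) auto
  finally show ?thesis .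
qed (simp add: not_integrable_integral_eq assms)

locale typed_walk = prob_space M + step_probs k \<delta> \<beta>
  for M :: "'a measure" and k :: nat and \<delta> :: real and \<beta> :: "nat \<Rightarrow> nat \<Rightarrow> real" +
  fixes W :: "nat \<Rightarrow> 'a \<Rightarrow> nat"
  assumes indep: "indep_vars (\<lambda>_. count_space UNIV) W {1..}"
    and distr: "\<And>i j. i \<ge> 1 \<Longrightarrow> j < k \<Longrightarrow> prob {x \<in> space M. W i x = j} = \<beta> i j"
begin

lemma measurable_W: "i \<ge> 1 \<Longrightarrow> W i \<in> measurable M (count_space UNIV)"
  using indep by (simp add: indep_vars_def)

lemma measurable_walk_W: "walk W i \<in> measurable M (count_space UNIV)"
  by (rule measurable_walk) (simp add: measurable_W)

lemma borel_measurable_walk: "(\<lambda>x. f (walk W i x)) \<in> borel_measurable M"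
  by (rule measurable_compose[OF measurable_walk_W]) simp

text \<open>The probabilities of the values below k add up to 1, so other values occur with
  probability 0.\<close>

lemma AE_W: "AE x in M. \<forall>i\<ge>1. W i x < k"
proof -
  have "AE x in M. W i x < k" if i: "i \<ge> 1" for i
  proof (rule AE_I_eq_1)
    have "{x \<in> space M. W i x \<in> A} \<in> sets M" for A
      using measurable_sets[OF measurable_W[OF i], of A] by (simp add: vimage_def Int_def conj_commute)
    note ms = this
    have "{x \<in> space M. W i x < k} = (\<Union>j<k. {x \<in> space M. W i x = j})" by auto
    also have "prob \<dots> = (\<Sum>j<k. prob {x \<in> space M. W i x = j})"
      using ms[of "{j}" for j] by (intro finite_measure_finite_Union) (auto simp: disjoint_family_on_def)
    also have "\<dots> = 1" using distr[OF i] \<beta>_sum[OF i] by simp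
    finally show "emeasure M {x \<in> space M. W i x < k} = 1" by (simp add: emeasure_eq_measure)
    show "{x \<in> space M. W i x < k} \<in> sets M" using ms[of "{..<k}"] by simp
  qed
  then show ?thesis by (subst AE_all_countable) auto
qed

lemma AE_sum_walk: "AE x in M. \<forall>i. (\<Sum>l<k. walk W i x l) = int i"
  using AE_W
proof eventually_elim
  case (elim x)
  show ?case
  proof
    fix i
    show "(\<Sum>l<k. walk W i x l) = int i"
    proof (induction i)
      case (Suc i)
      have "W (Suc i) x < k" using elim by simp
      then have "(\<Sum>l<k. basis_vec (W (Suc i) x) l) = 1" by (simp add: basis_vec_def)
      then show ?case using Suc by (simp add: walk_Suc sum.distrib)
    qed (simp add: walk_0)
  qed
qed

lemma integrable_walk:
  fixes f :: "(nat \<Rightarrow> int) \<Rightarrow> real"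
  assumes "\<And>v. \<bar>f v\<bar> \<le> B"
  shows "integrable M (\<lambda>x. f (walk W i x))"
  by (rule integrable_const_bound[of _ B]) (use assms borel_measurable_walk in auto)

lemma integrable_walk2:
  fixes f g :: "(nat \<Rightarrow> int) \<Rightarrow> real"
  assumes "\<And>v. \<bar>f v\<bar> \<le> B" "\<And>v. \<bar>g v\<bar> \<le> C"
  shows "integrable M (\<lambda>x. g (walk W i x) * f (walk W j x))"
proof (rule integrable_const_bound[of _ "C * B"])
  have "0 \<le> C" using assms(2)[of undefined] by linarith
  then show "AE x in M. norm (g (walk W i x) * f (walk W j x)) \<le> C * B"
    using assms by (auto simp: abs_mult intro!: mult_mono AE_I2)
  show "(\<lambda>x. g (walk W i x) * f (walk W j x)) \<in> borel_measurable M"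
    by (intro borel_measurable_times borel_measurable_walk)
qed

text \<open>The Markov property for one step. The last step is split by its value a:
  \<open>F a\<close> depends on the steps 1 to j and \<open>Z a\<close> on step j + 1, so
  independence factors each expectation.\<close>

lemma expectation_step:
  fixes f g :: "(nat \<Rightarrow> int) \<Rightarrow> real"
  assumes f: "\<And>v. \<bar>f v\<bar> \<le> B" and g: "\<And>v. \<bar>g v\<bar> \<le> C" and ij: "i \<le> j"
  shows "expectation (\<lambda>x. g (walk W i x) * f (walk W (Suc j) x))
       = expectation (\<lambda>x. g (walk W i x) * step_op k (\<beta> (Suc j)) f (walk W j x))"
proof -
  define F where "F a = (\<lambda>x. g (walk W i x) * f (\<lambda>l. walk W j x l + basis_vec a l))" for a
  define Z where "Z a = (\<lambda>x. indicator {a} (W (Suc j) x) :: real)" for a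
  have intF: "integrable M (F a)" for a
    unfolding F_def using f g by (rule integrable_walk2[where f="\<lambda>v. f (\<lambda>l. v l + basis_vec a l)"])
  have Zm: "Z a \<in> borel_measurable M" for a
    unfolding Z_def by (rule measurable_compose[OF measurable_W]) auto
  have intZ: "integrable M (Z a)" for a
    by (rule integrable_const_bound[where B=1]) (simp_all only: Zm, simp add: Z_def indicator_def)
  have ind: "indep_var borel (F a) borel (Z a)" for a
  proof -
    \<comment> \<open>Past and future live on separate path spaces; walking along the coordinate
      projections expresses \<open>F a\<close> as a function of the restricted path.\<close>
    let ?P = "PiM {1..j} (\<lambda>_. count_space UNIV) :: (nat \<Rightarrow> nat) measure"
    let ?Q = "PiM {Suc j} (\<lambda>_. count_space UNIV) :: (nat \<Rightarrow> nat) measure"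
    let ?V = "\<lambda>t w. w t :: nat"
    have comp: "walk ?V i' \<in> measurable ?P (count_space UNIV)" if "i' \<le> j" for i'
      using that by (intro measurable_walk measurable_component_singleton) auto
    have "indep_var ?P (\<lambda>x. restrict (\<lambda>t. W t x) {1..j}) ?Q (\<lambda>x. restrict (\<lambda>t. W t x) {Suc j})"
      by (rule indep_var_restrict[OF indep]) auto
    moreover have "(\<lambda>w. g (walk ?V i w) * f (\<lambda>l. walk ?V j w l + basis_vec a l)) \<in> borel_measurable ?P"
      by (intro borel_measurable_times measurable_compose[OF comp[OF ij]]
            measurable_compose[OF comp[OF order_refl], of "\<lambda>v. f (\<lambda>l. v l + basis_vec a l)"]) auto
    moreover have "(\<lambda>w. indicator {a} (w (Suc j)) :: real) \<in> borel_measurable ?Q"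
      by (rule measurable_compose[OF measurable_component_singleton[of "Suc j"]]) simp_all
    ultimately have "indep_var borel ((\<lambda>w. g (walk ?V i w) * f (\<lambda>l. walk ?V j w l + basis_vec a l)) \<circ> (\<lambda>x. restrict (\<lambda>t. W t x) {1..j}))
        borel ((\<lambda>w. indicator {a} (w (Suc j)) :: real) \<circ> (\<lambda>x. restrict (\<lambda>t. W t x) {Suc j}))"
      by (rule indep_var_compose)
    moreover have "walk ?V i' (restrict (\<lambda>t. W t x) {1..j}) = walk W i' x" if "i' \<le> j" for i' x
      using that by (intro walk_cong) auto
    ultimately show ?thesis using ij by (simp add: comp_def F_def Z_def)
  qed
  have EZ: "expectation (Z a) = \<beta> (Suc j) a" if "a < k" for a
  proof -
    have "Z a = indicator {x. W (Suc j) x = a}" by (auto simp: Z_def indicator_def)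
    then have "expectation (Z a) = prob ({x. W (Suc j) x = a} \<inter> space M)" by simp
    also have "{x. W (Suc j) x = a} \<inter> space M = {x \<in> space M. W (Suc j) x = a}" by auto
    finally show ?thesis using distr[of "Suc j" a] that by simp
  qed
  have "expectation (\<lambda>x. g (walk W i x) * f (walk W (Suc j) x)) = expectation (\<lambda>x. \<Sum>a<k. F a x * Z a x)"
  proof (rule integral_cong_AE)
    show "(\<lambda>x. \<Sum>a<k. F a x * Z a x) \<in> borel_measurable M"
      using intF Zm by (intro borel_measurable_sum borel_measurable_times) auto
    show "AE x in M. g (walk W i x) * f (walk W (Suc j) x) = (\<Sum>a<k. F a x * Z a x)"
      using AE_W
    proof eventually_elim
      case (elim x)
      have "(\<Sum>a<k. F a x * Z a x) = (\<Sum>a<k. if a = W (Suc j) x then F a x else 0)"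
        by (intro sum.cong) (auto simp: Z_def)
      then show ?case using elim by (simp add: F_def walk_Suc)
    qed
  qed (intro borel_measurable_times borel_measurable_walk)
  also have "\<dots> = (\<Sum>a<k. expectation (\<lambda>x. F a x * Z a x))"
    by (intro Bochner_Integration.integral_sum indep_var_integrable[OF ind intF intZ])
  also have "\<dots> = (\<Sum>a<k. \<beta> (Suc j) a * expectation (F a))"
    using indep_var_lebesgue_integral[OF ind intF intZ] by (intro sum.cong) (auto simp: EZ)
  also have "\<dots> = expectation (\<lambda>x. \<Sum>a<k. \<beta> (Suc j) a * F a x)"
    using intF by simp
  also have "\<dots> = expectation (\<lambda>x. g (walk W i x) * step_op k (\<beta> (Suc j)) f (walk W j x))"
    by (simp add: step_op_def F_def sum_distrib_left mult_ac)
  finally show ?thesis .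
qed

lemma abs_step_op_le:
  fixes f :: "(nat \<Rightarrow> int) \<Rightarrow> real"
  assumes "\<And>v. \<bar>f v\<bar> \<le> B" "t \<ge> 1"
  shows "\<bar>step_op k (\<beta> t) f v\<bar> \<le> B"
proof -
  have "\<bar>step_op k (\<beta> t) f v\<bar> \<le> (\<Sum>a<k. \<bar>\<beta> t a *\<^sub>R f (\<lambda>l. v l + basis_vec a l)\<bar>)"
    unfolding step_op_def by (rule sum_abs)
  also have "\<dots> \<le> (\<Sum>a<k. \<beta> t a * B)"
    using assms by (intro sum_mono) (auto simp: abs_mult \<beta>_nonneg intro!: mult_left_mono)
  also have "\<dots> = B" using \<beta>_sum[OF assms(2)] by (simp add: sum_distrib_right[symmetric])
  finally show ?thesis .
qed

lemma expectation_evol: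
  fixes f g :: "(nat \<Rightarrow> int) \<Rightarrow> real"
  assumes "\<And>v. \<bar>f v\<bar> \<le> B" and g: "\<And>v. \<bar>g v\<bar> \<le> C"
  shows "expectation (\<lambda>x. g (walk W i x) * f (walk W (i + L) x))
       = expectation (\<lambda>x. g (walk W i x) * evol k \<beta> i L f (walk W i x))"
  using assms(1)
proof (induction L arbitrary: f)
  case (Suc L)
  have bound: "\<bar>step_op k (\<beta> (Suc (i + L))) f v\<bar> \<le> B" for v
    by (rule abs_step_op_le[where f=f, OF Suc.prems]) simp
  have "expectation (\<lambda>x. g (walk W i x) * f (walk W (Suc (i + L)) x))
      = expectation (\<lambda>x. g (walk W i x) * step_op k (\<beta> (Suc (i + L))) f (walk W (i + L) x))"
    by (rule expectation_step[where f=f and g=g, OF Suc.prems g]) simp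
  also have "\<dots> = expectation (\<lambda>x. g (walk W i x) * evol k \<beta> i L (step_op k (\<beta> (Suc (i + L))) f) (walk W i x))"
    by (rule Suc.IH[OF bound])
  finally show ?case by simp
qed simp

lemma abs_evol_le:
  fixes f :: "(nat \<Rightarrow> int) \<Rightarrow> real"
  assumes "\<And>v. \<bar>f v\<bar> \<le> B"
  shows "\<bar>evol k \<beta> i L f v\<bar> \<le> B"
  using assms
proof (induction L arbitrary: f)
  case (Suc L)
  have "\<bar>step_op k (\<beta> (Suc (i + L))) f v\<bar> \<le> B" for v
    by (rule abs_step_op_le[where f=f, OF Suc.prems]) simp
  then show ?case by (simp add: Suc.IH)
qed simp

end

text \<open>The gcd n of the coordinates divides their sum j. So the divisors of j that divide every
  coordinate are exactly the divisors of n, and j > 0 ensures n > 0.\<close>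

lemma visible_eq_sum_mu:
  assumes "(\<Sum>l<k. v l) = int j" "0 < j"
  shows "(if visible k v then 1 else 0) = (\<Sum>d | d dvd j. mu d * ind_dvd k d v)"
proof -
  define n where "n = nat (Gcd (v ` {..<k}))"
  have n: "int n = Gcd (v ` {..<k})" by (simp add: n_def)
  have dvd_n: "(\<forall>l<k. int d dvd v l) \<longleftrightarrow> d dvd n" for d
  proof -
    have "d dvd n \<longleftrightarrow> int d dvd Gcd (v ` {..<k})" by (simp only: n[symmetric] int_dvd_int_iff)
    then show ?thesis by (auto simp: dvd_Gcd_iff)
  qed
  have "int n dvd (\<Sum>l<k. v l)" using dvd_n[of n] by (intro dvd_sum) simp
  then have nj: "n dvd j" by (simp add: assms)
  then have n0: "0 < n" using assms by (auto intro: Nat.gr0I)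
  have "(\<Sum>d | d dvd j. mu d * ind_dvd k d v) = (\<Sum>d | d dvd n. mu d)"
  proof (rule sum.mono_neutral_cong_right)
    show "finite {d. d dvd j}" using assms by simp
    show "{d. d dvd n} \<subseteq> {d. d dvd j}" using nj dvd_trans by blast
  qed (auto simp: ind_dvd_def dvd_n)
  also have "\<dots> = (if n = 1 then 1 else 0)" using n0 by (rule sum_mu_divisors)
  also have "\<dots> = (if visible k v then 1 else 0)" by (simp add: visible_def n[symmetric])
  finally show ?thesis by simp
qed

section \<open>Divisor sums on average and the error terms\<close>

lemma sum_divisors_swap_le:
  fixes h :: "nat \<Rightarrow> real"
  assumes "\<And>d. 0 \<le> h d"
  shows "(\<Sum>j=1..n. \<Sum>d | d dvd j \<and> z < d. h d) \<le> real n * (\<Sum>d\<in>{z<..n}. h d / real d)"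
proof -
  have "(\<Sum>d | d dvd j \<and> z < d. h d) = (\<Sum>d\<in>{z<..n}. if d dvd j then h d else 0)" if "j \<in> {1..n}" for j
  proof (rule sum.mono_neutral_cong_left)
    show "{d. d dvd j \<and> z < d} \<subseteq> {z<..n}" using that by (auto dest: dvd_imp_le)
  qed auto
  then have "(\<Sum>j=1..n. \<Sum>d | d dvd j \<and> z < d. h d) = (\<Sum>j=1..n. \<Sum>d\<in>{z<..n}. if d dvd j then h d else 0)"
    by (rule sum.cong[OF refl])
  also have "\<dots> = (\<Sum>d\<in>{z<..n}. \<Sum>j=1..n. if d dvd j then h d else 0)" by (rule sum.swap)
  also have "\<dots> = (\<Sum>d\<in>{z<..n}. h d * real (card {j\<in>{1..n}. d dvd j \<and> True}))"
    by (intro sum.cong refl) (simp add: sum.If_cases Int_def)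
  also have "\<dots> \<le> (\<Sum>d\<in>{z<..n}. h d * (real n / real d))"
    by (intro sum_mono mult_left_mono card_multiples_le assms) auto
  also have "\<dots> = real n * (\<Sum>d\<in>{z<..n}. h d / real d)"
    by (simp add: sum_distrib_left mult_ac)
  finally show ?thesis .
qed

text \<open>Comparison with the telescoping differences 1 / n - 1 / (n + 1).\<close>

lemma sum_inverse_squares_tail:
  assumes "0 < z"
  shows "(\<Sum>d\<in>{z<..n}. 1 / (real d)\<^sup>2) \<le> 1 / real z"
proof (cases "z \<le> n")
  case True
  then have "(\<Sum>d\<in>{z<..n}. 1 / (real d)\<^sup>2) \<le> 1 / real z - 1 / real n"
  proof (induction n rule: dec_induct)
    case (step n)
    have "{z<..Suc n} = insert (Suc n) {z<..n}" using step by auto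
    moreover have "1 / (real (Suc n))\<^sup>2 \<le> 1 / real n - 1 / real (Suc n)"
    proof -
      have n: "0 < n" using step assms by simp
      have "1 / (real (Suc n))\<^sup>2 \<le> 1 / (real n * real (Suc n))"
        unfolding power2_eq_square using n by (intro frac_le mult_right_mono) auto
      also have "\<dots> = 1 / real n - 1 / real (Suc n)" using n by (simp add: field_simps)
      finally show ?thesis .
    qed
    ultimately show ?case using step by simp
  qed simp
  then show ?thesis using assms by (smt (verit) zero_le_divide_1_iff of_nat_0_le_iff)
qed simp

lemma sum_harm_tail: "(\<Sum>d\<in>{z<..n}. 1 / real d) \<le> harm n"
  unfolding harm_def inverse_eq_divide by (rule sum_mono2) auto

lemma harm_mono_real: "m \<le> n \<Longrightarrow> harm m \<le> (harm n :: real)"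
  unfolding harm_def by (rule sum_mono2) auto

lemma abs_vis_density_le:
  assumes "k \<ge> 2" "1 \<le> j" "j \<le> n"
  shows "\<bar>vis_density k j\<bar> \<le> harm n"
proof -
  have "\<bar>vis_density k j\<bar> \<le> (\<Sum>d | d dvd j. \<bar>mu d / real d ^ (k - 1)\<bar>)"
    unfolding vis_density_def by (rule sum_abs)
  also have "\<dots> \<le> (\<Sum>d | d dvd j. 1 / real d)"
  proof (rule sum_mono)
    fix d assume "d \<in> {d. d dvd j}"
    then have d: "1 \<le> real d" using assms by (cases "d = 0") auto
    have "\<bar>mu d / real d ^ (k - 1)\<bar> \<le> 1 / real d ^ (k - 1)"
      using abs_mu_le_1[of d] by (simp add: abs_divide divide_right_mono)
    also have "\<dots> \<le> 1 / real d ^ 1"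
      using d assms by (intro divide_left_mono power_increasing mult_pos_pos) auto
    finally show "\<bar>mu d / real d ^ (k - 1)\<bar> \<le> 1 / real d" by simp
  qed
  also have "\<dots> \<le> (\<Sum>d=1..n. 1 / real d)"
  proof (rule sum_mono2)
    show "{d. d dvd j} \<subseteq> {1..n}"
    proof
      fix d assume "d \<in> {d. d dvd j}"
      then show "d \<in> {1..n}" using assms dvd_imp_le[of d j] dvd_pos_nat[of j d] by auto
    qed
  qed auto
  also have "\<dots> = harm n" by (simp add: harm_def inverse_eq_divide)
  finally show ?thesis .
qed

context step_probs
begin

text \<open>Here \<open>n\<close> is the time horizon, \<open>L0\<close> the least time lag, and \<open>z\<close> separates small from large divisors.\<close>

definition err :: "nat \<Rightarrow> nat \<Rightarrow> nat \<Rightarrow> nat \<Rightarrow> real" where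
  "err n z L0 j = real z * exp (- 8 * \<delta>\<^sup>2 * real L0 / (real z)\<^sup>2)
     + (\<Sum>d | d dvd j \<and> z < d. 2 / real d + harm n / (2 * \<delta> * sqrt (real L0)))"

lemma err_nonneg: "0 \<le> err n z L0 j"
proof -
  have "0 \<le> harm n / (2 * \<delta> * sqrt (real L0))"
    using \<delta> by (intro divide_nonneg_nonneg harm_nonneg) auto
  then show ?thesis
    unfolding err_def by (intro add_nonneg_nonneg mult_nonneg_nonneg sum_nonneg) auto
qed

text \<open>Divisors up to z, at most z in number, use the exponentially small error. Larger ones
  are estimated without cancellation: one 1 / d comes from the divisibility probability and the
  other from the density 1 / d ^ (k - 1), giving 2 / d.\<close>

lemma evol_visible:
  assumes v: "(\<Sum>l<k. v l) = int i" and L: "1 \<le> L0" "L0 \<le> L" and j: "i + L \<le> n" and z: "1 \<le> z"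
  shows "\<bar>evol k \<beta> i L (\<lambda>v. \<Sum>d | d dvd i + L. mu d * ind_dvd k d v) v - vis_density k (i + L)\<bar> \<le> err n z L0 (i + L)"
proof -
  let ?D = "{d. d dvd i + L}"
  let ?A = "exp (- 8 * \<delta>\<^sup>2 * real L0 / (real z)\<^sup>2)"
  define D where "D d = evol k \<beta> i L (ind_dvd k d) v - 1 / real d ^ (k - 1)" for d
  have fin: "finite ?D" using L by simp
  have "evol k \<beta> i L (\<lambda>v. \<Sum>d\<in>?D. mu d * ind_dvd k d v) v - vis_density k (i + L) = (\<Sum>d\<in>?D. mu d * D d)"
    by (simp add: evol_sum evol_mult vis_density_def D_def sum_subtractf right_diff_distrib)
  then have "\<bar>evol k \<beta> i L (\<lambda>v. \<Sum>d\<in>?D. mu d * ind_dvd k d v) v - vis_density k (i + L)\<bar> \<le> (\<Sum>d\<in>?D. \<bar>mu d * D d\<bar>)"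
    by (simp add: sum_abs)
  also have "\<dots> \<le> (\<Sum>d\<in>?D. \<bar>D d\<bar>)"
    using abs_mu_le_1 by (intro sum_mono) (simp add: abs_mult mult_left_le_one_le)
  also have "\<dots> = (\<Sum>d | d dvd i + L \<and> d \<le> z. \<bar>D d\<bar>) + (\<Sum>d | d dvd i + L \<and> z < d. \<bar>D d\<bar>)"
    using fin by (subst sum.union_disjoint[symmetric]) (auto intro!: sum.cong)
  also have "\<dots> \<le> real z * ?A + (\<Sum>d | d dvd i + L \<and> z < d. 2 / real d + harm n / (2 * \<delta> * sqrt (real L0)))"
  proof (rule add_mono)
    have pos: "0 < d" if "d dvd i + L" for d using that L by (cases "d = 0") auto
    have "\<bar>D d\<bar> \<le> ?A" if d: "d dvd i + L" "d \<le> z" for d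
    proof -
      have "int d dvd (\<Sum>l<k. v l) + int L" using d unfolding v by (metis int_dvd_int_iff of_nat_add)
      then have "\<bar>D d\<bar> \<le> exp (- 8 * \<delta>\<^sup>2 * real L / (real d)\<^sup>2)"
        unfolding D_def using pos[OF d(1)] by (intro evol_ind_dvd_small)
      also have "\<dots> \<le> ?A"
      proof -
        have "8 * \<delta>\<^sup>2 * real L0 / (real z)\<^sup>2 \<le> 8 * \<delta>\<^sup>2 * real L / (real d)\<^sup>2"
          using pos[OF d(1)] d L \<delta> by (intro frac_le mult_mono power_mono) auto
        then show ?thesis by simp
      qed
      finally show ?thesis .
    qed
    then have "(\<Sum>d | d dvd i + L \<and> d \<le> z. \<bar>D d\<bar>) \<le> real (card {d. d dvd i + L \<and> d \<le> z}) * ?A"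
      by (intro sum_bounded_above) auto
    also have "card {d. d dvd i + L \<and> d \<le> z} \<le> card {1..z}"
      using pos by (intro card_mono) (auto simp: Suc_le_eq)
    finally show "(\<Sum>d | d dvd i + L \<and> d \<le> z. \<bar>D d\<bar>) \<le> real z * ?A" by (simp add: mult_right_mono)
    show "(\<Sum>d | d dvd i + L \<and> z < d. \<bar>D d\<bar>) \<le> (\<Sum>d | d dvd i + L \<and> z < d. 2 / real d + harm n / (2 * \<delta> * sqrt (real L0)))"
    proof (rule sum_mono)
      fix d assume "d \<in> {d. d dvd i + L \<and> z < d}"
      then have d: "d dvd i + L" "0 < d" "d \<le> n" using z j L pos dvd_imp_le[of d "i + L"] by auto
      have "\<bar>evol k \<beta> i L (ind_dvd k d) v\<bar> \<le> 1 / real d + harm d / (2 * \<delta> * sqrt (real L))"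
        using d L by (intro evol_ind_dvd_large) auto
      also have "harm d / (2 * \<delta> * sqrt (real L)) \<le> harm n / (2 * \<delta> * sqrt (real L0))"
        using d L \<delta> by (intro frac_le mult_mono harm_mono_real) (auto intro: harm_nonneg)
      finally have "\<bar>evol k \<beta> i L (ind_dvd k d) v\<bar> \<le> 1 / real d + harm n / (2 * \<delta> * sqrt (real L0))" by simp
      moreover have "\<bar>1 / real d ^ (k - 1)\<bar> \<le> 1 / real d"
      proof -
        have "real d ^ 1 \<le> real d ^ (k - 1)" using d k2 by (intro power_increasing) auto
        then show ?thesis using d by (simp add: frac_le)
      qed
      moreover have "\<bar>D d\<bar> \<le> \<bar>evol k \<beta> i L (ind_dvd k d) v\<bar> + \<bar>1 / real d ^ (k - 1)\<bar>"
        unfolding D_def by (rule abs_triangle_ineq4)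
      moreover have "2 / real d = 1 / real d + 1 / real d" by simp
      ultimately show "\<bar>D d\<bar> \<le> 2 / real d + harm n / (2 * \<delta> * sqrt (real L0))"
        by linarith
    qed
  qed
  finally show ?thesis by (simp add: err_def)
qed

text \<open>A single time may have many large divisors, so that part of \<open>err\<close> is
  controlled only on average over j.\<close>

lemma sum_err_le:
  assumes "1 \<le> L0" "1 \<le> z"
  shows "(\<Sum>j=1..n. err n z L0 j) \<le> real n * (real z * exp (- 8 * \<delta>\<^sup>2 * real L0 / (real z)\<^sup>2)
     + 2 / real z + (harm n)\<^sup>2 / (2 * \<delta> * sqrt (real L0)))"
proof -
  let ?c = "harm n / (2 * \<delta> * sqrt (real L0))"
  have c: "0 \<le> ?c" using \<delta> by (simp add: harm_nonneg)
  have "(\<Sum>j=1..n. \<Sum>d | d dvd j \<and> z < d. 2 / real d + ?c) \<le> real n * (\<Sum>d\<in>{z<..n}. (2 / real d + ?c) / real d)"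
    using c by (intro sum_divisors_swap_le) auto
  also have "(\<Sum>d\<in>{z<..n}. (2 / real d + ?c) / real d) = 2 * (\<Sum>d\<in>{z<..n}. 1 / (real d)\<^sup>2) + ?c * (\<Sum>d\<in>{z<..n}. 1 / real d)"
    unfolding sum_distrib_left sum.distrib[symmetric]
    by (intro sum.cong refl) (simp add: add_divide_distrib power2_eq_square)
  also have "real n * \<dots> \<le> real n * (2 * (1 / real z) + ?c * harm n)"
    using sum_inverse_squares_tail[of z n] sum_harm_tail[of z n] assms c
    by (intro mult_left_mono add_mono) auto
  finally have "(\<Sum>j=1..n. \<Sum>d | d dvd j \<and> z < d. 2 / real d + ?c) \<le> real n * (2 / real z + (harm n)\<^sup>2 / (2 * \<delta> * sqrt (real L0)))"
    by (simp add: power2_eq_square)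
  then show ?thesis by (simp add: err_def sum.distrib distrib_left)
qed

end

section \<open>Correlations of visibility at distant times\<close>

context typed_walk
begin

lemma Xvis_borel: "Xvis k W i \<in> borel_measurable M"
  unfolding Xvis_def[abs_def] by (rule borel_measurable_walk)

text \<open>Conditioning on the position at time i replaces the later factor by its evolution, which
  is close to the density; the earlier factor is merely bounded by 1 + harm n.\<close>

lemma correlation_le:
  assumes i: "1 \<le> i" and L: "1 \<le> L0" "L0 \<le> L" and j: "i + L \<le> n" and z: "1 \<le> z"
  shows "\<bar>expectation (\<lambda>x. (Xvis k W i x - vis_density k i) * (Xvis k W (i + L) x - vis_density k (i + L)))\<bar>
    \<le> (1 + harm n) * err n z L0 (i + L)"
proof -
  let ?g = "\<lambda>v. (if visible k v then 1 else 0) - vis_density k i"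
  \<comment> \<open>The divisor sum agrees with the visibility indicator only at positions whose
    coordinates sum to i + L, hence almost surely along the walk.\<close>
  define f where "f = (\<lambda>v. \<Sum>d | d dvd i + L. mu d * ind_dvd k d v)"
  \<comment> \<open>This bound serves integrability only and does not enter the estimate.\<close>
  define B where "B = real (card {d. d dvd i + L})"
  define h where "h = (\<lambda>v. f v - vis_density k (i + L))"
  have g: "\<bar>?g v\<bar> \<le> 1 + harm n" for v
    using abs_vis_density_le[OF k2 i, of n] j by (auto simp: abs_le_iff)
  have f: "\<bar>f v\<bar> \<le> B" for v
  proof -
    have "\<bar>f v\<bar> \<le> (\<Sum>d | d dvd i + L. \<bar>mu d * ind_dvd k d v\<bar>)" unfolding f_def by (rule sum_abs)
    also have "\<dots> \<le> (\<Sum>d | d dvd i + L. 1)"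
      using abs_mu_le_1 by (intro sum_mono) (simp add: ind_dvd_def)
    finally show ?thesis by (simp add: B_def)
  qed
  have E: "\<bar>evol k \<beta> i L f v\<bar> \<le> B" for v by (rule abs_evol_le[OF f])
  have "expectation (\<lambda>x. (Xvis k W i x - vis_density k i) * (Xvis k W (i + L) x - vis_density k (i + L)))
     = expectation (\<lambda>x. ?g (walk W i x) * f (walk W (i + L) x) - vis_density k (i + L) * ?g (walk W i x))"
  proof (rule integral_cong_AE)
    show "AE x in M. (Xvis k W i x - vis_density k i) * (Xvis k W (i + L) x - vis_density k (i + L))
        = ?g (walk W i x) * f (walk W (i + L) x) - vis_density k (i + L) * ?g (walk W i x)"
      using AE_sum_walk
    proof eventually_elim
      case (elim x)
      have "Xvis k W (i + L) x = f (walk W (i + L) x)"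
        unfolding Xvis_def f_def using elim L by (intro visible_eq_sum_mu) auto
      then show ?case by (simp add: Xvis_def algebra_simps)
    qed
  qed (intro borel_measurable_times borel_measurable_diff borel_measurable_const Xvis_borel borel_measurable_walk
        borel_measurable_walk[of ?g])+
  also have "\<dots> = expectation (\<lambda>x. ?g (walk W i x) * f (walk W (i + L) x)) - expectation (\<lambda>x. vis_density k (i + L) * ?g (walk W i x))"
    by (intro Bochner_Integration.integral_diff integrable_mult_right integrable_walk2[OF f g] integrable_walk[OF g])
  also have "expectation (\<lambda>x. ?g (walk W i x) * f (walk W (i + L) x)) = expectation (\<lambda>x. ?g (walk W i x) * evol k \<beta> i L f (walk W i x))"
    by (rule expectation_evol[OF f g])
  also have "\<dots> - expectation (\<lambda>x. vis_density k (i + L) * ?g (walk W i x))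
      = expectation (\<lambda>x. ?g (walk W i x) * evol k \<beta> i L f (walk W i x) - vis_density k (i + L) * ?g (walk W i x))"
    by (intro Bochner_Integration.integral_diff[symmetric] integrable_mult_right integrable_walk2[OF E g] integrable_walk[OF g])
  finally have eq: "expectation (\<lambda>x. (Xvis k W i x - vis_density k i) * (Xvis k W (i + L) x - vis_density k (i + L)))
      = expectation (\<lambda>x. ?g (walk W i x) * (evol k \<beta> i L f (walk W i x) - vis_density k (i + L)))"
    by (simp add: right_diff_distrib mult.commute)
  have ae: "AE x in M. \<bar>?g (walk W i x) * (evol k \<beta> i L f (walk W i x) - vis_density k (i + L))\<bar> \<le> (1 + harm n) * err n z L0 (i + L)"
    using AE_sum_walk
  proof eventually_elim
    case (elim x)
    have "\<bar>evol k \<beta> i L f (walk W i x) - vis_density k (i + L)\<bar> \<le> err n z L0 (i + L)"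
      unfolding f_def using elim by (intro evol_visible L j z) auto
    then show ?case unfolding abs_mult using g[of "walk W i x"] by (intro mult_mono) auto
  qed
  show ?thesis
    unfolding eq by (rule abs_expectation_le[OF ae]) (intro mult_nonneg_nonneg add_nonneg_nonneg harm_nonneg err_nonneg zero_le_one)
qed

end

subsection \<open>Almost sure convergence\<close>

text \<open>For s ^ q <= n < (s + 1) ^ q, monotonicity traps A n / n between neighbouring
  subsequence values up to the factor ((s + 1) / s) ^ q, which tends to 1.\<close>

lemma tendsto_from_power_subsequence:
  fixes A :: "nat \<Rightarrow> real"
  assumes mono: "mono A" and nonneg: "\<And>n. 0 \<le> A n" and q: "0 < q"
    and lim: "(\<lambda>s. A (s ^ q) / real (s ^ q)) \<longlonglongrightarrow> l"
  shows "(\<lambda>n. A n / real n) \<longlonglongrightarrow> l"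
proof -
  define rt where "rt = nth_root_nat q"
  define u where "u s = A (s ^ q) / real (s ^ q)" for s
  have rt1: "rt n ^ q \<le> n" for n
    using q by (simp add: rt_def nth_root_nat_power_le)
  have rt2: "n < Suc (rt n) ^ q" for n
    using nth_root_nat_ge[OF q, of "Suc (rt n)" n] by (auto simp: rt_def not_le[symmetric])
  have rt_top: "filterlim rt at_top at_top"
    unfolding filterlim_at_top
  proof
    fix Z
    show "\<forall>\<^sub>F n in at_top. Z \<le> rt n"
      using eventually_ge_at_top[of "Z ^ q"] by eventually_elim (simp add: rt_def nth_root_nat_ge q)
  qed
  have u: "u \<longlonglongrightarrow> l" using lim by (simp add: u_def[abs_def])
  have "(\<lambda>s. real s / real (Suc s)) \<longlonglongrightarrow> 1" by real_asymp
  from tendsto_mult[OF u tendsto_power[OF this, of q]]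
  have lo: "(\<lambda>s. u s * (real s / real (Suc s)) ^ q) \<longlonglongrightarrow> l" by simp
  have "(\<lambda>s. real (Suc s) / real s) \<longlonglongrightarrow> 1" by real_asymp
  from tendsto_mult[OF LIMSEQ_Suc[OF u] tendsto_power[OF this, of q]]
  have hi: "(\<lambda>s. u (Suc s) * (real (Suc s) / real s) ^ q) \<longlonglongrightarrow> l" by simp
  show ?thesis
  proof (rule tendsto_sandwich[OF _ _ filterlim_compose[OF lo rt_top] filterlim_compose[OF hi rt_top]])
    have *: "u (rt n) * (real (rt n) / real (Suc (rt n))) ^ q \<le> A n / real n
        \<and> A n / real n \<le> u (Suc (rt n)) * (real (Suc (rt n)) / real (rt n)) ^ q" if "1 \<le> n" for n
    proof
      define s where "s = rt n"
      have s: "1 \<le> s" using nth_root_nat_ge[OF q, of 1 n] that by (simp add: s_def rt_def)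
      have s1: "s ^ q \<le> n" and s2: "n \<le> Suc s ^ q" using rt1[of n] rt2[of n] by (simp_all add: s_def)
      have "u s * (real s / real (Suc s)) ^ q = A (s ^ q) / real (Suc s ^ q)"
        using s by (simp add: u_def power_divide)
      also have "\<dots> \<le> A n / real n"
        using s1 s2 that by (intro frac_le nonneg monoD[OF mono]) (auto simp del: of_nat_power)
      finally show "u (rt n) * (real (rt n) / real (Suc (rt n))) ^ q \<le> A n / real n" by (simp add: s_def)
      have "A n / real n \<le> A (Suc s ^ q) / real (s ^ q)"
        using s1 s2 s by (intro frac_le nonneg monoD[OF mono]) (auto simp del: of_nat_power)
      also have "\<dots> = u (Suc s) * (real (Suc s) / real s) ^ q"
        by (simp add: u_def power_divide del: of_nat_Suc)
      finally show "A n / real n \<le> u (Suc (rt n)) * (real (Suc (rt n)) / real (rt n)) ^ q" by (simp add: s_def)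
    qed
    show "\<forall>\<^sub>F n in sequentially. u (rt n) * (real (rt n) / real (Suc (rt n))) ^ q \<le> A n / real n"
      using eventually_ge_at_top[of 1] by eventually_elim (use * in blast)
    show "\<forall>\<^sub>F n in sequentially. A n / real n \<le> u (Suc (rt n)) * (real (Suc (rt n)) / real (rt n)) ^ q"
      using eventually_ge_at_top[of 1] by eventually_elim (use * in blast)
  qed
qed

text \<open>The sum over s of the squares has finite expectation, so it is almost surely finite and
  its terms tend to 0.\<close>

lemma (in prob_space) AE_tendsto_0_of_second_moments:
  fixes D :: "nat \<Rightarrow> 'a \<Rightarrow> real"
  assumes D: "\<And>s. D s \<in> borel_measurable M" and int: "\<And>s. integrable M (\<lambda>x. (D s x)\<^sup>2)"
    and bound: "\<And>s. expectation (\<lambda>x. (D s x)\<^sup>2) \<le> b s" and b: "summable b"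
  shows "AE x in M. (\<lambda>s. D s x) \<longlonglongrightarrow> 0"
proof -
  have meas: "(\<lambda>x. ennreal ((D s x)\<^sup>2)) \<in> borel_measurable M" for s using D by measurable
  have nn: "0 \<le> expectation (\<lambda>x. (D s x)\<^sup>2)" for s by simp
  have "(\<integral>\<^sup>+x. (\<Sum>s. ennreal ((D s x)\<^sup>2)) \<partial>M) = (\<Sum>s. ennreal (expectation (\<lambda>x. (D s x)\<^sup>2)))"
    using meas by (subst nn_integral_suminf) (auto intro!: suminf_cong nn_integral_eq_integral int)
  also have "\<dots> \<noteq> \<infinity>"
  proof -
    have "summable (\<lambda>s. expectation (\<lambda>x. (D s x)\<^sup>2))"
      by (rule summable_comparison_test'[OF b, of 0]) (use bound nn in auto)
    from ennreal_suminf_neq_top[OF this nn] show ?thesis by simp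
  qed
  finally have "AE x in M. (\<Sum>s. ennreal ((D s x)\<^sup>2)) \<noteq> \<infinity>"
    using meas by (intro nn_integral_PInf_AE) auto
  then show ?thesis
  proof eventually_elim
    case (elim x)
    then have "summable (\<lambda>s. (D s x)\<^sup>2)" by (intro summable_suminf_not_top) auto
    then have "(\<lambda>s. sqrt ((D s x)\<^sup>2)) \<longlonglongrightarrow> sqrt 0" by (intro tendsto_real_sqrt summable_LIMSEQ_zero)
    then show ?case by (simp add: tendsto_rabs_zero_iff)
  qed
qed

text \<open>Bounding ln s by s is crude but harmless, since the rates below leave room for several
  powers of s.\<close>

lemma harm_power_le:
  assumes "1 \<le> s"
  shows "harm (s ^ q) \<le> 1 + real q * real s"
proof -
  have "harm (s ^ q) - ln (real (s ^ q)) \<le> harm 1 - ln (real 1)"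
    using assms by (intro euler_mascheroni_sequence_decreasing) auto
  moreover have "ln (real (s ^ q)) = real q * ln (real s)"
    using assms by (simp add: ln_realpow)
  moreover have "real q * ln (real s) \<le> real q * real s"
    using assms ln_le_minus_one[of "real s"] by (intro mult_left_mono) auto
  ultimately show ?thesis by (simp add: harm_def)
qed

section \<open>Second moments along the times s ^ 32\<close>

context typed_walk
begin

text \<open>Expanding the square, pairs at distance below L0 are bounded trivially, at most 2 * L0
  of them for each i. All other pairs fall under the correlation bound.\<close>

lemma second_moment_le:
  assumes L0: "1 \<le> L0" and z: "1 \<le> z" and n: "1 \<le> n" and S: "S \<subseteq> {1..n}"
  shows "expectation (\<lambda>x. ((\<Sum>i\<in>S. Xvis k W i x - vis_density k i) / real n)\<^sup>2)
    \<le> 2 * real L0 * (1 + harm n)\<^sup>2 / real n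
      + 2 * (1 + harm n) * (real z * exp (- 8 * \<delta>\<^sup>2 * real L0 / (real z)\<^sup>2) + 2 / real z
          + (harm n)\<^sup>2 / (2 * \<delta> * sqrt (real L0)))"
proof -
  define B where "B = 1 + (harm n :: real)"
  define Y where "Y i x = Xvis k W i x - vis_density k i" for i x
  define e where "e = err n z L0"
  \<comment> \<open>Including both \<open>e i\<close> and \<open>e j\<close> covers either order of
    the two times. As c is nonnegative, the double sum can be enlarged from S to {1..n}.\<close>
  define c where "c i j = (if i < j + L0 \<and> j < i + L0 then B\<^sup>2 else 0) + B * (e i + e j)" for i j
  have fin: "finite S" using S finite_subset by blast
  have B: "0 \<le> B" by (simp add: B_def harm_nonneg)
  have e: "0 \<le> e i" for i unfolding e_def by (rule err_nonneg)
  have c: "0 \<le> c i j" for i j using B e by (simp add: c_def)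
  have Ym: "Y i \<in> borel_measurable M" for i
    unfolding Y_def[abs_def] by (intro borel_measurable_diff Xvis_borel borel_measurable_const)
  have YB: "\<bar>Y i x\<bar> \<le> B" if "i \<in> {1..n}" for i x
    using abs_vis_density_le[OF k2, of i n] that by (auto simp: Y_def B_def Xvis_def abs_le_iff)
  have YYB: "\<bar>Y i x * Y j x\<bar> \<le> B\<^sup>2" if "i \<in> {1..n}" "j \<in> {1..n}" for i j x
    unfolding abs_mult power2_eq_square using YB that by (intro mult_mono) (auto simp: B)
  have YYint: "integrable M (\<lambda>x. Y i x * Y j x)" if "i \<in> {1..n}" "j \<in> {1..n}" for i j
    using YYB[OF that] by (intro integrable_const_bound[of _ "B\<^sup>2"] borel_measurable_times Ym AE_I2) simp
  have far: "expectation (\<lambda>x. Y i x * Y j x) \<le> B * e j" if "i \<in> {1..n}" "j \<in> {1..n}" "i + L0 \<le> j" for i j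
    using correlation_le[of i L0 "j - i" n z] that L0 z by (simp add: Y_def B_def e_def abs_le_iff)
  have Yc: "expectation (\<lambda>x. Y i x * Y j x) \<le> c i j" if ij: "i \<in> {1..n}" "j \<in> {1..n}" for i j
  proof -
    consider "i < j + L0 \<and> j < i + L0" | "i + L0 \<le> j" | "j + L0 \<le> i" by linarith
    then show ?thesis
    proof cases
      case 1
      have "\<bar>expectation (\<lambda>x. Y i x * Y j x)\<bar> \<le> B\<^sup>2"
        by (rule abs_expectation_le) (use YYB[OF ij] in auto)
      moreover have "0 \<le> B * (e i + e j)" using B e by simp
      ultimately show ?thesis using 1 by (simp add: c_def)
    next
      case 2
      have "B * e j \<le> B * (e i + e j)" using B e by (intro mult_left_mono) auto
      then show ?thesis using far[OF ij 2] 2 by (simp add: c_def)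
    next
      case 3
      have "B * e i \<le> B * (e i + e j)" using B e by (intro mult_left_mono) auto
      then show ?thesis using far[OF ij(2,1) 3] 3 by (simp add: c_def mult.commute)
    qed
  qed
  have "expectation (\<lambda>x. (\<Sum>i\<in>S. Y i x)\<^sup>2) = expectation (\<lambda>x. \<Sum>i\<in>S. \<Sum>j\<in>S. Y i x * Y j x)"
    by (simp add: power2_eq_square sum_product)
  also have "\<dots> = (\<Sum>i\<in>S. \<Sum>j\<in>S. expectation (\<lambda>x. Y i x * Y j x))"
    using S by (subst Bochner_Integration.integral_sum Bochner_Integration.integrable_sum;
        (intro sum.cong refl Bochner_Integration.integral_sum Bochner_Integration.integrable_sum YYint)?) auto
  also have "\<dots> \<le> (\<Sum>i\<in>S. \<Sum>j\<in>S. c i j)"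
    using S by (intro sum_mono Yc) auto
  also have "\<dots> \<le> (\<Sum>i\<in>S. \<Sum>j=1..n. c i j)"
    using S c by (intro sum_mono sum_mono2) auto
  also have "\<dots> \<le> (\<Sum>i=1..n. \<Sum>j=1..n. c i j)"
    using S c by (intro sum_mono2) (auto intro: sum_nonneg)
  also have "\<dots> \<le> (\<Sum>i=1..n. 2 * real L0 * B\<^sup>2 + B * (real n * e i + sum e {1..n}))"
  proof (rule sum_mono)
    fix i
    have "(\<Sum>j=1..n. if i < j + L0 \<and> j < i + L0 then B\<^sup>2 else 0) \<le> 2 * real L0 * B\<^sup>2"
    proof -
      have "(\<Sum>j=1..n. if i < j + L0 \<and> j < i + L0 then B\<^sup>2 else 0)
          = real (card {j\<in>{1..n}. i < j + L0 \<and> j < i + L0}) * B\<^sup>2"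
        by (simp add: sum.If_cases Int_def)
      also have "card {j\<in>{1..n}. i < j + L0 \<and> j < i + L0} \<le> card {i + 1 - L0..<i + L0}"
        by (intro card_mono) auto
      also have "\<dots> \<le> 2 * L0" by simp
      finally show ?thesis by (simp add: mult_right_mono)
    qed
    moreover have "(\<Sum>j=1..n. B * (e i + e j)) = B * (real n * e i + sum e {1..n})"
      by (simp add: sum_distrib_left[symmetric] sum.distrib)
    ultimately show "(\<Sum>j=1..n. c i j) \<le> 2 * real L0 * B\<^sup>2 + B * (real n * e i + sum e {1..n})"
      by (simp add: c_def sum.distrib)
  qed
  also have "\<dots> = 2 * real n * real L0 * B\<^sup>2 + 2 * B * real n * sum e {1..n}"
    by (simp add: sum.distrib sum_distrib_left[symmetric] algebra_simps)
  also have "\<dots> \<le> 2 * real n * real L0 * B\<^sup>2 + 2 * B * real n * (real n * (real z * exp (- 8 * \<delta>\<^sup>2 * real L0 / (real z)\<^sup>2)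
     + 2 / real z + (harm n)\<^sup>2 / (2 * \<delta> * sqrt (real L0))))"
    unfolding e_def using B by (intro add_left_mono mult_left_mono sum_err_le L0 z) auto
  finally have "expectation (\<lambda>x. (\<Sum>i\<in>S. Y i x)\<^sup>2) / (real n)\<^sup>2 \<le> (2 * real n * real L0 * B\<^sup>2 + 2 * B * real n * (real n * (real z * exp (- 8 * \<delta>\<^sup>2 * real L0 / (real z)\<^sup>2)
     + 2 / real z + (harm n)\<^sup>2 / (2 * \<delta> * sqrt (real L0))))) / (real n)\<^sup>2"
    by (rule divide_right_mono) simp
  also have "\<dots> = 2 * real L0 * B\<^sup>2 / real n + 2 * B * (real z * exp (- 8 * \<delta>\<^sup>2 * real L0 / (real z)\<^sup>2)
     + 2 / real z + (harm n)\<^sup>2 / (2 * \<delta> * sqrt (real L0)))"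
    using n by (simp add: add_divide_distrib power2_eq_square)
  finally show ?thesis
    by (simp add: power_divide Y_def B_def)
qed

text \<open>The parameters are n = s ^ 32, L0 = s ^ 16 and z = s ^ 4. Then L0 / z^2 = s ^ 8 makes
  the exponential negligible, the near pairs give order s ^ -14, and the bracket is O(s ^ -3). The
  factor 1 + harm n <= 34 s leaves s ^ -2, which is summable.\<close>

lemma second_moment_rate:
  assumes s: "1 \<le> s" and S: "S \<subseteq> {1..s ^ 32}"
  shows "expectation (\<lambda>x. ((\<Sum>i\<in>S. Xvis k W i x - vis_density k i) / real (s ^ 32))\<^sup>2)
    \<le> (2 * 34\<^sup>2 + 68 * (1 / (8 * \<delta>\<^sup>2) + 2 + 33\<^sup>2 / (2 * \<delta>))) / (real s)\<^sup>2"
proof -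
  define t where "t = real s"
  have t: "1 \<le> t" using s by (simp add: t_def)
  have h0: "0 \<le> (harm (s ^ 32) :: real)" by (rule harm_nonneg)
  have h: "harm (s ^ 32) \<le> 33 * t" using harm_power_le[OF s, of 32] t by (simp add: t_def)
  have h1: "1 + harm (s ^ 32) \<le> 34 * t" using h t by simp
  have exp_le: "t ^ 4 * exp (- 8 * \<delta>\<^sup>2 * t ^ 16 / (t ^ 4)\<^sup>2) \<le> 1 / (8 * \<delta>\<^sup>2) / t ^ 3"
  proof -
    have "- 8 * \<delta>\<^sup>2 * t ^ 16 / (t ^ 4)\<^sup>2 = - (8 * \<delta>\<^sup>2 * t ^ 8)"
      using t by (simp add: power_mult[symmetric] field_simps power_add[symmetric])
    moreover have "exp (- (8 * \<delta>\<^sup>2 * t ^ 8)) \<le> 1 / (8 * \<delta>\<^sup>2 * t ^ 8)"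
    proof -
      have "8 * \<delta>\<^sup>2 * t ^ 8 \<le> exp (8 * \<delta>\<^sup>2 * t ^ 8)"
        using exp_ge_add_one_self[of "8 * \<delta>\<^sup>2 * t ^ 8"] by linarith
      moreover have "0 < 8 * \<delta>\<^sup>2 * t ^ 8" using \<delta> t by simp
      ultimately show ?thesis by (simp add: exp_minus inverse_eq_divide frac_le)
    qed
    ultimately have "t ^ 4 * exp (- 8 * \<delta>\<^sup>2 * t ^ 16 / (t ^ 4)\<^sup>2) \<le> t ^ 4 * (1 / (8 * \<delta>\<^sup>2 * t ^ 8))"
      using t by (simp only:) (intro mult_left_mono, auto)
    also have "\<dots> = 1 / (8 * \<delta>\<^sup>2) / t ^ 4"
      using t \<delta> by (simp add: field_simps power_add[symmetric])
    also have "\<dots> \<le> 1 / (8 * \<delta>\<^sup>2) / t ^ 3"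
      using t by (intro divide_left_mono power_increasing mult_pos_pos) auto
    finally show ?thesis .
  qed
  have z_le: "2 / t ^ 4 \<le> 2 / t ^ 3"
    using t by (intro divide_left_mono power_increasing mult_pos_pos) auto
  have sq: "sqrt (t ^ 16) = t ^ 8"
    using t by (intro real_sqrt_unique) (auto simp: power_mult[symmetric])
  have H_le: "(harm (s ^ 32))\<^sup>2 / (2 * \<delta> * sqrt (t ^ 16)) \<le> 33\<^sup>2 / (2 * \<delta>) / t ^ 3"
  proof -
    have "(harm (s ^ 32))\<^sup>2 / (2 * \<delta> * sqrt (t ^ 16)) \<le> (33 * t)\<^sup>2 / (2 * \<delta> * t ^ 8)"
      unfolding sq using h h0 \<delta> t by (intro divide_right_mono power_mono) auto
    also have "\<dots> = 33\<^sup>2 / (2 * \<delta>) / t ^ 6"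
      using t \<delta> by (simp add: field_simps power_add[symmetric] power_mult_distrib)
    also have "\<dots> \<le> 33\<^sup>2 / (2 * \<delta>) / t ^ 3"
      using t \<delta> by (intro divide_left_mono power_increasing mult_pos_pos) auto
    finally show ?thesis .
  qed
  have first: "2 * t ^ 16 * (1 + harm (s ^ 32))\<^sup>2 / t ^ 32 \<le> 2 * 34\<^sup>2 / t\<^sup>2"
  proof -
    have "2 * t ^ 16 * (1 + harm (s ^ 32))\<^sup>2 / t ^ 32 \<le> 2 * t ^ 16 * (34 * t)\<^sup>2 / t ^ 32"
      using h1 h0 t by (intro divide_right_mono mult_left_mono power_mono) auto
    also have "\<dots> = 2 * 34\<^sup>2 / t ^ 14"
      using t by (simp add: field_simps power_add[symmetric] power_mult_distrib)
    also have "\<dots> \<le> 2 * 34\<^sup>2 / t\<^sup>2"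
      using t by (intro divide_left_mono power_increasing mult_pos_pos) auto
    finally show ?thesis .
  qed
  let ?Q = "1 / (8 * \<delta>\<^sup>2) + 2 + 33\<^sup>2 / (2 * \<delta>)"
  have Q: "0 \<le> ?Q" using \<delta> by simp
  have "expectation (\<lambda>x. ((\<Sum>i\<in>S. Xvis k W i x - vis_density k i) / real (s ^ 32))\<^sup>2)
     \<le> 2 * t ^ 16 * (1 + harm (s ^ 32))\<^sup>2 / t ^ 32
       + 2 * (1 + harm (s ^ 32)) * (t ^ 4 * exp (- 8 * \<delta>\<^sup>2 * t ^ 16 / (t ^ 4)\<^sup>2) + 2 / t ^ 4
          + (harm (s ^ 32))\<^sup>2 / (2 * \<delta> * sqrt (t ^ 16)))"
    using second_moment_le[of "s ^ 16" "s ^ 4" "s ^ 32" S] s S by (simp add: t_def)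
  also have "\<dots> \<le> 2 * 34\<^sup>2 / t\<^sup>2 + 2 * (34 * t) * (?Q / t ^ 3)"
  proof (rule add_mono[OF first], rule mult_mono)
    show "t ^ 4 * exp (- 8 * \<delta>\<^sup>2 * t ^ 16 / (t ^ 4)\<^sup>2) + 2 / t ^ 4 + (harm (s ^ 32))\<^sup>2 / (2 * \<delta> * sqrt (t ^ 16)) \<le> ?Q / t ^ 3"
      using exp_le z_le H_le unfolding add_divide_distrib by linarith
    show "0 \<le> t ^ 4 * exp (- 8 * \<delta>\<^sup>2 * t ^ 16 / (t ^ 4)\<^sup>2) + 2 / t ^ 4 + (harm (s ^ 32))\<^sup>2 / (2 * \<delta> * sqrt (t ^ 16))"
      using t \<delta> by (intro add_nonneg_nonneg mult_nonneg_nonneg divide_nonneg_nonneg) auto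
  qed (use h1 t in auto)
  also have "2 * (34 * t) * (?Q / t ^ 3) = 68 * ?Q / t\<^sup>2"
    using t by (simp add: power2_eq_square power3_eq_cube)
  finally show ?thesis by (simp add: t_def add_divide_distrib)
qed

end

section \<open>Almost sure limits modulo prime powers\<close>

context typed_walk
begin

lemma AE_tendsto_S_bar:
  assumes p: "prime p" and r: "r \<ge> 1" and a: "a < p ^ r"
  shows "AE x in M. (\<lambda>n. S_bar k W (p ^ r) a n x) \<longlonglongrightarrow>
    (if p dvd a then real p ^ (k - 1) - 1 else real p ^ (k - 1)) * real p
        / (real p ^ r * (real p ^ k - 1)) * (1 / zeta_nat k)"
    (is "AE x in M. _ \<longlonglongrightarrow> ?l")
proof -
  define S where "S n = {i\<in>{1..n}. i mod p ^ r = a}" for n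
  define D where "D s x = (\<Sum>i\<in>S (s ^ 32). Xvis k W i x - vis_density k i) / real (s ^ 32)" for s x
  have Dm: "D s \<in> borel_measurable M" for s
    unfolding D_def[abs_def]
    by (intro borel_measurable_divide borel_measurable_sum borel_measurable_diff Xvis_borel borel_measurable_const)
  define C where "C = 2 * 34\<^sup>2 + 68 * (1 / (8 * \<delta>\<^sup>2) + 2 + 33\<^sup>2 / (2 * \<delta>))"
  have "AE x in M. (\<lambda>s. D s x) \<longlonglongrightarrow> 0"
  proof (rule AE_tendsto_0_of_second_moments[OF Dm])
    show "integrable M (\<lambda>x. (D s x)\<^sup>2)" for s
    proof (rule integrable_const_bound)
      let ?B = "(\<Sum>i\<in>S (s ^ 32). 1 + \<bar>vis_density k i\<bar>) / real (s ^ 32)"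
      have "\<bar>D s x\<bar> \<le> ?B" for x
        unfolding D_def abs_divide abs_of_nat
        by (intro divide_right_mono sum_norm_le[where 'a=real, unfolded real_norm_def]) (auto simp: Xvis_def)
      then have "(D s x)\<^sup>2 \<le> ?B\<^sup>2" for x by (intro abs_le_square_iff[THEN iffD1] order_trans[OF _ abs_ge_self])
      then show "AE x in M. norm ((D s x)\<^sup>2) \<le> ?B\<^sup>2" by simp
    qed (use Dm in measurable)
    show "expectation (\<lambda>x. (D s x)\<^sup>2) \<le> C / (real s)\<^sup>2" for s
    \<comment> \<open>At s = 0 both sides are 0 because division by 0 gives 0.\<close>
    proof (cases "s = 0")
      case False
      then show ?thesis
        unfolding D_def C_def by (intro second_moment_rate) (auto simp: S_def)
    qed (simp add: D_def)
    show "summable (\<lambda>s. C / (real s)\<^sup>2)"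
      using summable_mult[OF summable_inverse_nat_power[of 2], of C] by simp
  qed
  then show ?thesis
  proof eventually_elim
    case (elim x)
    \<comment> \<open>The fluctuations \<open>D\<close> are not monotone, so the mean density is
      added back first; the resulting visibility counts are monotone and can be
      interpolated.\<close>
    define A where "A n = (\<Sum>i\<in>S n. Xvis k W i x)" for n
    have "filterlim (\<lambda>s::nat. s ^ 32) at_top at_top"
      by (rule filterlim_subseq) (auto simp: strict_mono_def power_strict_mono)
    from filterlim_compose[OF mean_vis_density[OF k2 p r a] this]
    have "(\<lambda>s. (\<Sum>i\<in>S (s ^ 32). vis_density k i) / real (s ^ 32)) \<longlonglongrightarrow> ?l" by (simp add: S_def)
    from tendsto_add[OF elim this] have "(\<lambda>s. A (s ^ 32) / real (s ^ 32)) \<longlonglongrightarrow> ?l"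
      by (simp add: D_def A_def sum_subtractf diff_divide_distrib)
    then have "(\<lambda>n. A n / real n) \<longlonglongrightarrow> ?l"
    proof (rule tendsto_from_power_subsequence[rotated 3])
      show "mono A" unfolding A_def
        by (intro monoI sum_mono2) (auto simp: S_def Xvis_def)
      show "0 \<le> A n" for n unfolding A_def by (intro sum_nonneg) (simp add: Xvis_def)
    qed simp
    then show ?case by (simp add: S_bar_def A_def S_def)
  qed
qed

end

theorem theorem1p2:
  fixes k q :: nat
    and alpha :: "nat \<Rightarrow> nat \<Rightarrow> real"
    and c :: "nat \<Rightarrow> nat"
    and M :: "'a measure"
    and W :: "nat \<Rightarrow> 'a \<Rightarrow> nat"
  assumes k2: "k \<ge> 2" and q1: "q \<ge> 1"
    and alpha_pos: "\<And>t j. t < q \<Longrightarrow> j < k \<Longrightarrow> 0 < alpha t j \<and> alpha t j < 1"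
    and alpha_sum: "\<And>t. t < q \<Longrightarrow> (\<Sum>j<k. alpha t j) = 1"
    and c_type: "\<And>i. i \<ge> 1 \<Longrightarrow> c i < q"
    and M: "prob_space M"
    and indep: "prob_space.indep_vars M (\<lambda>_. count_space UNIV) W {1..}"
    and distr: "\<And>i j. i \<ge> 1 \<Longrightarrow> j < k \<Longrightarrow>
                  measure M {x \<in> space M. W i x = j} = alpha (c i) j"
  shows "(\<forall>r a. r \<ge> 1 \<longrightarrow> a < 2 ^ r \<longrightarrow>
            (AE x in M. (\<lambda>n. S_bar k W (2 ^ r) a n x) \<longlonglongrightarrow>
               (if odd a
                then (2 powi (int k - int r)) / (2 ^ k - 1) * (1 / zeta_nat k)
                else (2 ^ (k - 1) - 1) / (2 ^ (r - 1) * (2 ^ k - 1)) * (1 / zeta_nat k))))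
       \<and> (\<forall>p a. prime p \<longrightarrow> p \<ge> 3 \<longrightarrow> a < p \<longrightarrow>
            (AE x in M. (\<lambda>n. S_bar k W p a n x) \<longlonglongrightarrow>
               (if a = 0
                then (real p ^ (k - 1) - 1) / (real p ^ k - 1) * (1 / zeta_nat k)
                else real p ^ (k - 1) / (real p ^ k - 1) * (1 / zeta_nat k))))"
proof -
  \<comment> \<open>Finitely many types with positive entries have a positive least entry, whatever
    sequence of types is chosen.\<close>
  define \<delta> where "\<delta> = Min ((\<lambda>(t, j). alpha t j) ` ({..<q} \<times> {..<k}))"
  have fin: "finite ((\<lambda>(t, j). alpha t j) ` ({..<q} \<times> {..<k}))" by simp
  have ne: "(\<lambda>(t, j). alpha t j) ` ({..<q} \<times> {..<k}) \<noteq> {}"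
    using k2 q1 by (auto simp: lessThan_empty_iff)
  have \<delta>_le: "\<delta> \<le> alpha t j" if "t < q" "j < k" for t j
    unfolding \<delta>_def by (rule Min_le[OF fin]) (use that in force)
  have \<delta>_pos: "0 < \<delta>"
    unfolding \<delta>_def using alpha_pos by (subst Min_gr_iff[OF fin ne]) auto
  interpret prob_space M by (rule M)
  interpret typed_walk M k \<delta> "\<lambda>t. alpha (c t)" W
    by unfold_locales (use k2 \<delta>_pos \<delta>_le c_type alpha_sum indep distr in auto)
  have k': "(2::real) ^ k = 2 * 2 ^ (k - 1)" using k2 by (metis Suc_diff_1 power_Suc less_le_trans zero_less_numeral)
  show ?thesis
  proof (intro conjI allI impI)
    fix r a :: nat
    assume r: "1 \<le> r" and a: "a < 2 ^ r"
    have r': "(2::real) ^ r = 2 * 2 ^ (r - 1)" using r by (metis Suc_diff_1 power_Suc less_le_trans zero_less_one)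
    have "(if 2 dvd a then real 2 ^ (k - 1) - 1 else real 2 ^ (k - 1)) * real 2 / (real 2 ^ r * (real 2 ^ k - 1)) * (1 / zeta_nat k)
      = (if odd a
         then (2 powi (int k - int r)) / (2 ^ k - 1) * (1 / zeta_nat k)
         else (2 ^ (k - 1) - 1) / (2 ^ (r - 1) * (2 ^ k - 1)) * (1 / zeta_nat k))"
    proof (cases "even a")
      case True
      have "x * 2 / (2 ^ r * y) = x / (2 ^ (r - 1) * y)" for x y :: real
        unfolding r' by simp
      then show ?thesis using True by (simp only: of_nat_numeral) simp
    next
      case False
      \<comment> \<open>The exponent k - r may be negative, hence the integer power.\<close>
      have "(2::real) powi (int k - int r) = 2 ^ (k - 1) * 2 / 2 ^ r"
        by (simp add: power_int_diff k')
      then show ?thesis using False by simp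
    qed
    then show "AE x in M. (\<lambda>n. S_bar k W (2 ^ r) a n x) \<longlonglongrightarrow>
        (if odd a
         then (2 powi (int k - int r)) / (2 ^ k - 1) * (1 / zeta_nat k)
         else (2 ^ (k - 1) - 1) / (2 ^ (r - 1) * (2 ^ k - 1)) * (1 / zeta_nat k))"
      using AE_tendsto_S_bar[OF two_is_prime_nat r a] by simp
  next
    fix p a :: nat
    assume p: "prime p" "3 \<le> p" and a: "a < p"
    \<comment> \<open>The odd primes are the case r = 1, where divisibility of a by p singles out
      the class 0.\<close>
    have "p dvd a \<longleftrightarrow> a = 0" using a by (auto dest: dvd_imp_le)
    then have "(if p dvd a then real p ^ (k - 1) - 1 else real p ^ (k - 1)) * real p / (real p ^ 1 * (real p ^ k - 1)) * (1 / zeta_nat k)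
      = (if a = 0
         then (real p ^ (k - 1) - 1) / (real p ^ k - 1) * (1 / zeta_nat k)
         else real p ^ (k - 1) / (real p ^ k - 1) * (1 / zeta_nat k))"
      using p by simp
    then show "AE x in M. (\<lambda>n. S_bar k W p a n x) \<longlonglongrightarrow>
        (if a = 0
         then (real p ^ (k - 1) - 1) / (real p ^ k - 1) * (1 / zeta_nat k)
         else real p ^ (k - 1) / (real p ^ k - 1) * (1 / zeta_nat k))"
      using AE_tendsto_S_bar[OF p(1), of 1 a] a by simp
  qed
qed

end
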